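(* Let $-A$ be the generator of a $C_0$-semigroup $(T(t))_{t\ge0}$ on a Hilbert space $X$ such that $\mathbb{C}_-\subseteq\rho(A)$. Let $\omega,M_\omega\ge1$ be such that $\|T(t)\|_{\mathcal{L}(X)}\le M_\omega e^{t(\omega-1)}$ for all $t\ge0$, and set $M:=\sup\{\|T(t)\|_{\mathcal{L}(X)}:t\in[0,2]\}$. Suppose that there exists a nondecreasing $g:(0,\infty)\to(0,\infty)$ such that $$\|(\lambda+A)^{-1}\|_{\mathcal{L}(X)}\le g(\mathrm{Re}(\lambda)^{-1})\qquad(\lambda\in\mathbb{C}_+).$$ Then $\|T(t)\|_{\mathcal{L}(X)}\le eM_\omega(1+2M\omega)(g(t)+1)$ for all $t>0$.
   Context: Hilbert spaces are nonzero and over $\mathbb{C}$; $\mathcal{L}(X)$ is the space of bounded operators on $X$. $\mathbb{C}_+=\{\mathrm{Re}(\lambda)>0\}$, $\mathbb{C}_-=-\mathbb{C}_+$; $\rho(A)$ is the resolvent set of $A$. *)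

theory Defs
  imports "HOL-Analysis.Analysis"
begin

class complex_vector = real_vector +
  fixes scaleC :: "complex \<Rightarrow> 'a \<Rightarrow> 'a" (infixr "*\<^sub>C" 75)
  assumes scaleC_add_right: "c *\<^sub>C (x + y) = c *\<^sub>C x + c *\<^sub>C y"
    and scaleC_add_left: "(c + d) *\<^sub>C x = c *\<^sub>C x + d *\<^sub>C x"
    and scaleC_scaleC: "c *\<^sub>C d *\<^sub>C x = (c * d) *\<^sub>C x"
    and scaleC_of_real: "complex_of_real r *\<^sub>C x = r *\<^sub>R x"

text \<open>The inner product is linear in the first argument. Positive definiteness is
  contained in \<open>cinner_self\<close>, since \<open>norm x = 0\<close> only for \<open>x = 0\<close>. The zero space is an
  instance of the class, so a nonzero space has to be assumed explicitly.\<close>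

class complex_hilbert_space = complex_vector + banach +
  fixes cinner :: "'a \<Rightarrow> 'a \<Rightarrow> complex"
  assumes cinner_add_left: "cinner (x + y) z = cinner x z + cinner y z"
    and cinner_scaleC_left: "cinner (c *\<^sub>C x) y = c * cinner x y"
    and cinner_commute: "cinner x y = cnj (cinner y x)"
    and cinner_self: "cinner x x = complex_of_real ((norm x)\<^sup>2)"

text \<open>For a bounded operator \<open>f\<close>, the norm of \<open>f\<close> in the space of bounded operators is
  \<open>onorm f\<close>; it does not depend on the choice of real or complex scalars.\<close>

definition bounded_clinear :: "('a \<Rightarrow> 'a::complex_hilbert_space) \<Rightarrow> bool" where
  "bounded_clinear f \<longleftrightarrow> bounded_linear f \<and> (\<forall>c x. f (c *\<^sub>C x) = c *\<^sub>C f x)"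

text \<open>The values \<open>T t\<close> for \<open>t < 0\<close> are irrelevant.\<close>

definition C0_semigroup :: "(real \<Rightarrow> 'a \<Rightarrow> 'a::complex_hilbert_space) \<Rightarrow> bool" where
  "C0_semigroup T \<longleftrightarrow>
     (\<forall>t\<ge>0. bounded_clinear (T t)) \<and>
     T 0 = id \<and>
     (\<forall>s\<ge>0. \<forall>t\<ge>0. T (s + t) = T s \<circ> T t) \<and>
     (\<forall>x. ((\<lambda>t. T t x) \<longlongrightarrow> x) (at_right 0))"

text \<open>An unbounded operator is given by its domain \<open>D\<close> and a function, whose values
  outside \<open>D\<close> are irrelevant.\<close>

definition is_generator ::
    "'a set \<Rightarrow> ('a \<Rightarrow> 'a) \<Rightarrow> (real \<Rightarrow> 'a \<Rightarrow> 'a::complex_hilbert_space) \<Rightarrow> bool" where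
  "is_generator D B T \<longleftrightarrow>
     D = {x. \<exists>y. ((\<lambda>h. (1 / h) *\<^sub>R (T h x - x)) \<longlongrightarrow> y) (at_right 0)} \<and>
     (\<forall>x\<in>D. ((\<lambda>h. (1 / h) *\<^sub>R (T h x - x)) \<longlongrightarrow> B x) (at_right 0))"

definition resolvent_set ::
    "'a set \<Rightarrow> ('a \<Rightarrow> 'a::complex_hilbert_space) \<Rightarrow> complex set" where
  "resolvent_set D A =
     {l. bij_betw (\<lambda>x. l *\<^sub>C x - A x) D UNIV \<and>
         bounded_clinear (inv_into D (\<lambda>x. l *\<^sub>C x - A x))}"

end

theory Submission
  imports Defs
begin

text \<open>
  Fix \<open>t\<close>, put \<open>a = 1 / t\<close> and \<open>K = g t\<close>. By monotonicity of \<open>g\<close>, the resolvents \<open>(l + A)\<^sup>-\<^sup>1\<close> are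
  bounded by \<open>K\<close> on the whole half-plane \<open>Re l \<ge> a\<close>, and it is enough to bound the rescaled semigroup
  \<open>exp (- a * s) T s\<close> by the constant \<open>C = M\<^sub>\<omega> (1 + 2 M \<omega>) (K + 1)\<close>, because the factor \<open>exp 1\<close>
  undoes the rescaling at \<open>s = t\<close>.

  The connection between resolvents and orbits is made by Fourier series. Let \<open>c \<ge> a\<close>, and let
  \<open>\<phi>\<close> be a scalar function that vanishes at \<open>0\<close> and at \<open>\<tau>\<close>. The function
  \<open>u s = \<phi> s * exp (- c * s) T s x\<close> solves \<open>u' + (c + A) u = f\<close> (in the mild sense) with
  \<open>f s = \<phi>' s * exp (- c * s) T s x\<close>, so the Fourier coefficients of \<open>u\<close> on the interval from \<open>0\<close> to
  \<open>\<tau>\<close> are those of \<open>f\<close>, each multiplied by a resolvent on the line \<open>Re l = c\<close>. As the values lie in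
  a Hilbert space, Parseval's and Bessel's inequalities show that the quadratic mean of \<open>u\<close>
  is at most \<open>K\<close> times that of \<open>f\<close> (\<open>integral_cutoff_orbit_le\<close>).

  If \<open>exp (- c * s) T s\<close> is already known to be bounded, by any constant, then \<open>\<phi>\<close> can be chosen
  such that the part of \<open>f\<close> that comes from the far end disappears for \<open>\<tau>\<close> tending to infinity,
  and what remains is an explicit bound of \<open>exp (- c * s) T s x\<close> in the quadratic mean
  (\<open>integral_orbit_le\<close>). The semigroup law turns it into the pointwise bound by \<open>C\<close>
  (\<open>onorm_T_le\<close>).

  It remains to remove the assumption of boundedness for \<open>c = a\<close>. It holds for \<open>c \<ge> \<omega> - 1\<close>.
  By Datko's argument, boundedness and the bound in the quadratic mean force the norm of
  \<open>exp (- c * s) T s\<close> to drop to one half at a time that depends on the constants only, and not on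
  \<open>c\<close>; hence \<open>c\<close> can be lowered by a fixed amount. Finitely many repetitions reach \<open>a\<close>
  (\<open>exponential_bound_of_resolvent_bound\<close>).
\<close>

section \<open>The real inner product\<close>

text \<open>Only the real part of the inner product enters below: it determines the norm, and it is
  real bilinear, so that it commutes with integrals of vector-valued functions.\<close>

definition rinner :: "'a::complex_hilbert_space \<Rightarrow> 'a \<Rightarrow> real" where
  "rinner x y = Re (cinner x y)"

lemma norm_scaleC: "norm (c *\<^sub>C x) = cmod c * norm (x::'a::complex_hilbert_space)"
proof -
  have "complex_of_real ((norm (c *\<^sub>C x))\<^sup>2) = c * cnj (c * cinner x x)"
    using cinner_self[of "c *\<^sub>C x"] cinner_scaleC_left cinner_commute by metis
  also have "\<dots> = complex_of_real ((cmod c * norm x)\<^sup>2)"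
    by (simp add: cinner_self power_mult_distrib mult.assoc[symmetric]
        flip: complex_norm_square)
  finally show ?thesis
    by (simp only: of_real_eq_iff power2_eq_iff_nonneg norm_ge_zero mult_nonneg_nonneg)
qed

lemma bounded_bilinear_scaleC:
  "bounded_bilinear (scaleC :: complex \<Rightarrow> 'a \<Rightarrow> 'a::complex_hilbert_space)"
proof
  fix r :: real and a :: complex and b :: 'a
  show "(r *\<^sub>R a) *\<^sub>C b = r *\<^sub>R (a *\<^sub>C b)"
    by (simp add: scaleC_scaleC scaleR_conv_of_real flip: scaleC_of_real)
  show "a *\<^sub>C (r *\<^sub>R b) = r *\<^sub>R (a *\<^sub>C b)"
    by (simp add: scaleC_scaleC mult.commute flip: scaleC_of_real)
  show "\<exists>K. \<forall>a b. norm (a *\<^sub>C (b::'a)) \<le> norm a * norm b * K"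
    by (intro exI[of _ 1]) (simp add: norm_scaleC)
qed (simp_all add: scaleC_add_left scaleC_add_right)

lemmas scaleC_uminus_left = bounded_bilinear.minus_left[OF bounded_bilinear_scaleC]
lemmas scaleC_sum_right = bounded_bilinear.sum_right[OF bounded_bilinear_scaleC]
lemmas scaleC_zero_right = bounded_bilinear.zero_right[OF bounded_bilinear_scaleC]
lemmas continuous_on_scaleC [continuous_intros] =
  bounded_bilinear.continuous_on[OF bounded_bilinear_scaleC]

lemma scaleC_one: "1 *\<^sub>C x = (x::'a::complex_vector)"
  using scaleC_of_real[of 1 x] by simp

lemma rinner_self: "rinner x x = (norm x)\<^sup>2"
  by (simp add: rinner_def cinner_self)

lemma rinner_commute: "rinner x y = rinner y x"
  by (metis rinner_def cinner_commute cnj.sel(1))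

lemma rinner_add_left: "rinner (x + y) z = rinner x z + rinner y z"
  by (simp add: rinner_def cinner_add_left)

lemma rinner_add_right: "rinner x (y + z) = rinner x y + rinner x z"
  by (metis rinner_add_left rinner_commute)

lemma rinner_scaleR_left: "rinner (r *\<^sub>R x) z = r * rinner x z"
  by (simp add: rinner_def cinner_scaleC_left flip: scaleC_of_real)

text \<open>The Cauchy-Schwarz inequality is a reformulation of the triangle inequality for the norm,
  after expanding \<open>(norm (x + y))\<^sup>2\<close>.\<close>

lemma rinner_le: "rinner x y \<le> norm x * norm y"
proof -
  have "(norm (x + y))\<^sup>2 = (norm x)\<^sup>2 + 2 * rinner x y + (norm y)\<^sup>2"
    by (simp add: rinner_add_left rinner_add_right rinner_commute[of y x] flip: rinner_self)
  moreover have "(norm (x + y))\<^sup>2 \<le> (norm x + norm y)\<^sup>2"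
    by (simp add: norm_triangle_ineq power_mono)
  ultimately show ?thesis
    by (simp add: power2_sum)
qed

lemma bounded_bilinear_rinner: "bounded_bilinear (rinner :: 'a \<Rightarrow> 'a::complex_hilbert_space \<Rightarrow> real)"
proof
  fix r :: real and a a' b b' :: 'a
  show "rinner (a + a') b = rinner a b + rinner a' b"
    by (rule rinner_add_left)
  show "rinner a (b + b') = rinner a b + rinner a b'"
    by (rule rinner_add_right)
  show "rinner (r *\<^sub>R a) b = r *\<^sub>R rinner a b"
    by (simp add: rinner_scaleR_left)
  show "rinner a (r *\<^sub>R b) = r *\<^sub>R rinner a b"
    by (metis rinner_scaleR_left rinner_commute real_scaleR_def)
  have "norm (rinner a b) \<le> norm a * norm b" for a b :: 'a
    using rinner_le[of a b] rinner_le[of "-a" b] rinner_scaleR_left[of "-1" a b]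
    by (simp add: abs_le_iff)
  then show "\<exists>K. \<forall>a b. norm (rinner a (b::'a)) \<le> norm a * norm b * K"
    by (intro exI[of _ 1]) simp
qed

interpretation rinner: bounded_bilinear rinner
  by (rule bounded_bilinear_rinner)

lemma rinner_scaleC_right:
  "rinner x (c *\<^sub>C y) = rinner (cnj c *\<^sub>C x) y"
proof -
  have "cinner x (c *\<^sub>C y) = cnj c * cinner x y"
    by (metis cinner_commute cinner_scaleC_left complex_cnj_mult complex_cnj_cnj)
  then show ?thesis
    by (simp add: rinner_def cinner_scaleC_left)
qed

lemma norm_diff_square: "(norm (x - y))\<^sup>2 = (norm x)\<^sup>2 - 2 * rinner x y + (norm y)\<^sup>2"
  by (simp add: rinner.diff_left rinner.diff_right rinner_commute[of y x] flip: rinner_self)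

section \<open>Fourier series of functions with values in a Hilbert space\<close>

text \<open>The closure properties needed are those under addition and under multiplication by
  real polynomials of \<open>cis x\<close>; an inductive definition makes both immediate, and the normal
  form with a finite set of frequencies is then read off by induction.\<close>

inductive trig_poly :: "(real \<Rightarrow> 'a::complex_hilbert_space) \<Rightarrow> bool" where
  monomial: "trig_poly (\<lambda>x. cis (of_int k * x) *\<^sub>C y)"
| add: "trig_poly p \<Longrightarrow> trig_poly q \<Longrightarrow> trig_poly (\<lambda>x. p x + q x)"

lemma trig_poly_expansion:
  assumes "trig_poly p"
  obtains I y where "finite I" "p = (\<lambda>x. \<Sum>k\<in>I. cis (of_int k * x) *\<^sub>C y k)"
  using assms
proof (induction arbitrary: thesis)
  case (monomial k y)
  show ?case
    by (rule monomial[of "{k}" "\<lambda>_. y"]) auto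
next
  case (add p q)
  obtain I y where p: "finite I" "p = (\<lambda>x. \<Sum>k\<in>I. cis (of_int k * x) *\<^sub>C y k)"
    using add.IH(1) .
  obtain J z where q: "finite J" "q = (\<lambda>x. \<Sum>k\<in>J. cis (of_int k * x) *\<^sub>C z k)"
    using add.IH(2) .
  let ?y = "\<lambda>k. if k \<in> I then y k else 0" and ?z = "\<lambda>k. if k \<in> J then z k else 0"
  have "p x = (\<Sum>k\<in>I \<union> J. cis (of_int k * x) *\<^sub>C ?y k)" for x
    unfolding p(2) by (rule sum.mono_neutral_cong_left) (auto simp: p q scaleC_zero_right)
  moreover have "q x = (\<Sum>k\<in>I \<union> J. cis (of_int k * x) *\<^sub>C ?z k)" for x
    unfolding q(2) by (rule sum.mono_neutral_cong_left) (auto simp: p q scaleC_zero_right)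
  ultimately show ?case
    using p(1) q(1)
    by (intro add.prems[of "I \<union> J" "\<lambda>k. ?y k + ?z k"])
       (simp_all only: finite_UnI scaleC_add_right sum.distrib)
qed

lemma trig_poly_scaleC: "trig_poly p \<Longrightarrow> trig_poly (\<lambda>x. c *\<^sub>C p x)"
proof (induction rule: trig_poly.induct)
  case (monomial k y)
  show ?case
    using trig_poly.monomial[of k "c *\<^sub>C y"] by (simp add: scaleC_scaleC mult.commute)
next
  case (add p q)
  then show ?case
    using trig_poly.add by (simp add: scaleC_add_right)
qed

lemma trig_poly_shift: "trig_poly p \<Longrightarrow> trig_poly (\<lambda>x. cis (of_int k * x) *\<^sub>C p x)"
proof (induction rule: trig_poly.induct)
  case (monomial l y)
  show ?case
    using trig_poly.monomial[of "k + l" y] by (simp add: scaleC_scaleC cis_mult distrib_right)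
next
  case (add p q)
  then show ?case
    using trig_poly.add by (simp add: scaleC_add_right)
qed

lemma trig_poly_scaleR: "trig_poly p \<Longrightarrow> trig_poly (\<lambda>x. r *\<^sub>R p x)"
  using trig_poly_scaleC[of p "complex_of_real r"] by (simp add: scaleC_of_real)

lemma trig_poly_sum:
  "finite J \<Longrightarrow> (\<And>j. j \<in> J \<Longrightarrow> trig_poly (p j)) \<Longrightarrow> trig_poly (\<lambda>x. \<Sum>j\<in>J. p j x)"
proof (induction rule: finite_induct)
  case empty
  show ?case
    using trig_poly.monomial[of 0 0] by (simp add: scaleC_zero_right)
qed (simp add: trig_poly.add)

text \<open>A linear functional of \<open>cis x\<close> is a combination of \<open>cis x\<close> and \<open>cis (- x)\<close>, so that
  multiplication by it shifts the frequencies by \<open>1\<close> in both directions.\<close>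

lemma trig_poly_mult_real_polynomial:
  assumes "real_polynomial_function f" "trig_poly p"
  shows "trig_poly (\<lambda>x. f (cis x) *\<^sub>R p x)"
  using assms
proof (induction arbitrary: p)
  case (linear f)
  define c where "c = complex_of_real (f 1) - \<i> * complex_of_real (f \<i>)"
  define d where "d = complex_of_real (f 1) + \<i> * complex_of_real (f \<i>)"
  have "f (cis x) = cos x * f 1 + sin x * f \<i>" for x
  proof -
    have "f (cis x) = f (cos x *\<^sub>R 1 + sin x *\<^sub>R \<i>)"
      by (rule arg_cong[where f = f]) (simp add: complex_eq_iff)
    then show ?thesis
      using linear.hyps by (simp add: bounded_linear.linear linear_add linear_scale)
  qed
  then have "complex_of_real (f (cis x)) = c / 2 * cis (of_int 1 * x) + d / 2 * cis (of_int (-1) * x)"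
    for x by (simp add: c_def d_def complex_eq_iff field_simps)
  then have "f (cis x) *\<^sub>R p x =
      (c / 2) *\<^sub>C (cis (of_int 1 * x) *\<^sub>C p x) + (d / 2) *\<^sub>C (cis (of_int (-1) * x) *\<^sub>C p x)" for x
    by (simp only: scaleC_scaleC flip: scaleC_add_left scaleC_of_real)
  then show ?case
    by (simp only: trig_poly.add trig_poly_scaleC trig_poly_shift linear.prems)
next
  case (const c)
  then show ?case by (rule trig_poly_scaleR)
next
  case (add f g)
  then show ?case by (simp add: scaleR_add_left trig_poly.add)
next
  case (mult f g)
  from mult.IH(1)[OF mult.IH(2)[OF mult.prems]] show ?case
    by simp
qed

text \<open>A continuous function on a compact set is uniformly close to a combination of finitely
  many of its values with coefficients from a partition of unity; these scalar coefficients are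
  replaced by polynomials with the Stone-Weierstrass theorem.\<close>

lemma Stone_Weierstrass_normed_space:
  fixes U :: "'b::euclidean_space \<Rightarrow> 'a::real_normed_vector"
  assumes S: "compact S" and U: "continuous_on S U" and e: "0 < e"
  obtains J P where "finite J" "\<And>j. j \<in> J \<Longrightarrow> real_polynomial_function (P j)"
    "\<And>z. z \<in> S \<Longrightarrow> norm (U z - (\<Sum>j\<in>J. P j z *\<^sub>R U j)) \<le> e"
proof -
  obtain b where b: "b > 0" "\<And>z. z \<in> S \<Longrightarrow> norm (U z) \<le> b"
    using compact_continuous_image[OF U S, THEN compact_imp_bounded] by (auto simp: bounded_pos)
  obtain \<delta> where \<delta>: "\<delta> > 0"
    "\<And>z w. z \<in> S \<Longrightarrow> w \<in> S \<Longrightarrow> dist w z < \<delta> \<Longrightarrow> dist (U w) (U z) < e / 2"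
    using compact_uniformly_continuous[OF U S] e
    unfolding uniformly_continuous_on_def by (meson half_gt_zero)
  obtain J where J: "finite J" "J \<subseteq> S" "S \<subseteq> (\<Union>j\<in>J. ball j \<delta>)"
    using seq_compact_imp_totally_bounded[of S] S \<delta>(1) unfolding compact_eq_seq_compact_metric
    by meson
  define \<psi> where "\<psi> j z = max 0 (\<delta> - dist j z)" for j z :: 'b
  define \<Psi> where "\<Psi> z = (\<Sum>j\<in>J. \<psi> j z)" for z
  define q where "q j z = \<psi> j z / \<Psi> z" for j z
  have \<psi>_nonneg: "\<psi> j z \<ge> 0" for j z
    by (simp add: \<psi>_def)
  have \<Psi>_pos: "\<Psi> z > 0" if z: "z \<in> S" for z
  proof -
    obtain j where j: "j \<in> J" "dist j z < \<delta>"
      using J(3) z by auto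
    then have "\<psi> j z > 0" by (simp add: \<psi>_def)
    then show ?thesis
      unfolding \<Psi>_def using j(1) J(1) \<psi>_nonneg by (intro sum_pos2)
  qed
  have q_cont: "continuous_on S (q j)" for j
    unfolding q_def \<Psi>_def \<psi>_def
    using \<Psi>_pos by (intro continuous_intros ballI) (simp add: \<Psi>_def \<psi>_def less_imp_neq[symmetric])
  have q_sum: "(\<Sum>j\<in>J. q j z) = 1" if "z \<in> S" for z
    using \<Psi>_pos[OF that] by (simp add: q_def \<Psi>_def flip: sum_divide_distrib)
  have q_nonneg: "q j z \<ge> 0" if "z \<in> S" for j z
    using \<Psi>_pos[OF that] by (simp add: q_def \<psi>_nonneg)
  \<comment> \<open>The total error from replacing the coefficients \<open>q j\<close> is \<open>card J * (\<eta> * b)\<close>, less than \<open>e / 2\<close>.\<close>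
  define \<eta> where "\<eta> = e / (2 * b * (card J + 1))"
  have \<eta>: "\<eta> > 0"
    using e b(1) by (simp add: \<eta>_def)
  have "\<exists>p. real_polynomial_function p \<and> (\<forall>z\<in>S. \<bar>q j z - p z\<bar> < \<eta>)" for j
    using Stone_Weierstrass_real_polynomial_function[OF S q_cont \<eta>, of j] by metis
  then obtain P where P: "\<And>j. real_polynomial_function (P j)"
      "\<And>j z. z \<in> S \<Longrightarrow> \<bar>q j z - P j z\<bar> < \<eta>"
    by metis
  have "norm (U z - (\<Sum>j\<in>J. P j z *\<^sub>R U j)) \<le> e" if z: "z \<in> S" for z
  proof -
    \<comment> \<open>Wherever \<open>q j\<close> does not vanish at \<open>z\<close>, the point \<open>j\<close> is close to \<open>z\<close>.\<close>
    have "U z - (\<Sum>j\<in>J. P j z *\<^sub>R U j) =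
        (\<Sum>j\<in>J. q j z *\<^sub>R (U z - U j)) + (\<Sum>j\<in>J. (q j z - P j z) *\<^sub>R U j)"
      using q_sum[OF z] scaleR_sum_left[of "\<lambda>j. q j z" J "U z"]
      by (simp add: scaleR_diff_right scaleR_diff_left sum_subtractf)
    also have "norm \<dots> \<le> (\<Sum>j\<in>J. norm (q j z *\<^sub>R (U z - U j))) + (\<Sum>j\<in>J. norm ((q j z - P j z) *\<^sub>R U j))"
      by (intro norm_triangle_le add_mono norm_sum)
    also have "\<dots> \<le> (\<Sum>j\<in>J. q j z * (e / 2)) + (\<Sum>j\<in>J. \<eta> * b)"
    proof (intro add_mono sum_mono)
      fix j assume j: "j \<in> J"
      show "norm (q j z *\<^sub>R (U z - U j)) \<le> q j z * (e / 2)"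
      proof (cases "dist j z < \<delta>")
        case True
        then have "norm (U z - U j) \<le> e / 2"
          using \<delta>(2)[of z j] z j J(2) by (auto simp: dist_norm norm_minus_commute)
        then have "q j z * norm (U z - U j) \<le> q j z * (e / 2)"
          using q_nonneg[OF z] by (rule mult_left_mono)
        then show ?thesis
          using q_nonneg[OF z, of j] by simp
      next
        case False
        then show ?thesis by (simp add: q_def \<psi>_def)
      qed
      have "\<bar>q j z - P j z\<bar> * norm (U j) \<le> \<eta> * b"
        using P(2)[OF z, of j] b(2)[of j] j J(2) \<eta> by (intro mult_mono) auto
      then show "norm ((q j z - P j z) *\<^sub>R U j) \<le> \<eta> * b"
        by simp
    qed
    also have "(\<Sum>j\<in>J. q j z * (e / 2)) = e / 2"
      unfolding sum_distrib_right[symmetric] q_sum[OF z] by simp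
    also have "(\<Sum>j\<in>J. \<eta> * b) \<le> e / 2"
    proof -
      define n where "n = real (card J) + 1"
      have "n > 0" "\<eta> = e / (2 * b * n)"
        by (simp_all add: n_def \<eta>_def add.commute)
      then have "(real (card J) + 1) * (\<eta> * b) = e / 2"
        using b(1) by (simp flip: n_def)
      then show ?thesis
        using mult_pos_pos[OF \<eta> b(1)] by (simp add: distrib_right)
    qed
    finally show ?thesis by simp
  qed
  then show thesis
    using that[of J P] J(1) P(1) by blast
qed

text \<open>A continuous periodic function is a continuous function on the unit circle. Real polynomials
  in the two coordinates of the circle become trigonometric polynomials.\<close>

lemma periodic_imp_approx_trig_poly:
  fixes u :: "real \<Rightarrow> 'a::complex_hilbert_space"
  assumes \<tau>: "\<tau> > 0" and u: "continuous_on {0..\<tau>} u" "u \<tau> = u 0" and e: "e > 0"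
  obtains I y where "finite I"
    "\<And>s. s \<in> {0..\<tau>} \<Longrightarrow> norm (u s - (\<Sum>k\<in>I. cis (of_int k * (2 * pi / \<tau>) * s) *\<^sub>C y k)) \<le> e"
proof -
  define v where "v r = u (\<tau> * r)" for r
  define U where "U = v \<circ> (\<lambda>z. Arg2pi z / (2 * pi))"
  have "continuous_on {0..1} v"
    unfolding v_def using \<tau>
    by (intro continuous_on_compose2[OF u(1)] continuous_intros) (auto simp: mult_left_le)
  then have "homotopic_loops UNIV v v"
    using u(2) by (simp add: homotopic_loops_refl path_def pathfinish_def pathstart_def v_def)
  then have U: "continuous_on (sphere 0 1) U"
    unfolding U_def by (blast dest: homotopic_loops_imp_homotopic_circlemaps homotopic_with_imp_continuous)
  have U_eq: "U (cis (2 * pi / \<tau> * s)) = u s" if s: "s \<in> {0..\<tau>}" for s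
  proof (cases "s = \<tau>")
    case True
    then show ?thesis
      using \<tau> u(2) by (simp add: U_def v_def Arg2pi_of_real[of 1, simplified])
  next
    case False
    have "Arg2pi (cis (2 * pi / \<tau> * s)) = 2 * pi / \<tau> * s"
      using s False \<tau> by (intro Arg2pi_unique[of 1]) (auto simp: cis_conv_exp field_simps)
    then show ?thesis
      using \<tau> by (simp add: U_def v_def)
  qed
  obtain J P where JP: "finite J" "\<And>j. j \<in> J \<Longrightarrow> real_polynomial_function (P j)"
    "\<And>z. z \<in> sphere 0 1 \<Longrightarrow> norm (U z - (\<Sum>j\<in>J. P j z *\<^sub>R U j)) \<le> e"
    by (rule Stone_Weierstrass_normed_space[OF compact_sphere U e]) blast
  have "trig_poly (\<lambda>x. U j)" for j
    using trig_poly.monomial[of 0 "U j"] by (simp add: scaleC_one)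
  then have "trig_poly (\<lambda>x. \<Sum>j\<in>J. P j (cis x) *\<^sub>R U j)"
    using JP by (intro trig_poly_sum trig_poly_mult_real_polynomial)
  then obtain I y where I: "finite I"
    "(\<lambda>x. \<Sum>j\<in>J. P j (cis x) *\<^sub>R U j) = (\<lambda>x. \<Sum>k\<in>I. cis (of_int k * x) *\<^sub>C y k)"
    by (rule trig_poly_expansion)
  have "norm (u s - (\<Sum>k\<in>I. cis (of_int k * (2 * pi / \<tau>) * s) *\<^sub>C y k)) \<le> e" if s: "s \<in> {0..\<tau>}" for s
    using JP(3)[of "cis (2 * pi / \<tau> * s)"] U_eq[OF s] fun_cong[OF I(2), of "2 * pi / \<tau> * s"]
    by (simp add: mult.assoc)
  then show thesis
    using that I(1) by blast
qed

definition fourier_coeff :: "real \<Rightarrow> (real \<Rightarrow> 'a::complex_hilbert_space) \<Rightarrow> int \<Rightarrow> 'a" where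
  "fourier_coeff \<tau> u k =
     (1 / \<tau>) *\<^sub>R integral {0..\<tau>} (\<lambda>s. cis (- (of_int k * (2 * pi / \<tau>) * s)) *\<^sub>C u s)"

lemma exp_has_vector_derivative:
  "((\<lambda>s. exp (c * complex_of_real s)) has_vector_derivative c * exp (c * complex_of_real s)) (at s within S)"
  by (rule has_vector_derivative_real_field) (auto intro!: derivative_eq_intros)

lemma has_integral_cis_scaleC:
  fixes y :: "'a::complex_hilbert_space"
  assumes \<tau>: "\<tau> > 0"
  shows "((\<lambda>s. cis (of_int k * (2 * pi / \<tau>) * s) *\<^sub>C y) has_integral (if k = 0 then \<tau> *\<^sub>R y else 0)) {0..\<tau>}"
proof (cases "k = 0")
  case True
  then show ?thesis
    using has_integral_const_real[of y 0 \<tau>] \<tau> by (simp add: scaleC_one)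
next
  case False
  define c where "c = \<i> * complex_of_real (of_int k * (2 * pi / \<tau>))"
  have c: "c \<noteq> 0"
    using False \<tau> by (simp add: c_def)
  have cis_eq: "cis (of_int k * (2 * pi / \<tau>) * s) = exp (c * complex_of_real s)" for s
    by (simp add: cis_conv_exp c_def mult.assoc)
  define F where "F s = (exp (c * complex_of_real s) / c) *\<^sub>C y" for s
  have "((\<lambda>s. exp (c * complex_of_real s) *\<^sub>C y) has_integral (F \<tau> - F 0)) {0..\<tau>}"
  proof (rule fundamental_theorem_of_calculus)
    fix s assume "s \<in> {0..\<tau>}"
    have "((\<lambda>s. exp (c * complex_of_real s) / c) has_vector_derivative exp (c * complex_of_real s))
        (at s within {0..\<tau>})"
      using has_vector_derivative_mult_left[OF exp_has_vector_derivative[of c s "{0..\<tau>}"], of "1 / c"] c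
      by simp
    from bounded_linear.has_vector_derivative[OF
        bounded_bilinear.bounded_linear_left[OF bounded_bilinear_scaleC] this]
    show "(F has_vector_derivative exp (c * complex_of_real s) *\<^sub>C y) (at s within {0..\<tau>})"
      unfolding F_def .
  qed (use \<tau> in simp)
  moreover have "F \<tau> = F 0"
  proof -
    have "of_int k * (2 * pi / \<tau>) * \<tau> = 2 * pi * of_int k"
      using \<tau> by simp
    then have "exp (c * complex_of_real \<tau>) = 1"
      unfolding cis_eq[symmetric] by (metis Ints_of_int cis_multiple_2pi)
    then show ?thesis by (simp add: F_def)
  qed
  ultimately show ?thesis
    using False by (simp only: cis_eq if_False diff_self)
qed

lemma fourier_coeff_trig_sum:
  fixes y :: "int \<Rightarrow> 'a::complex_hilbert_space"
  assumes \<tau>: "\<tau> > 0" and I: "finite I" "k \<in> I"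
  shows "fourier_coeff \<tau> (\<lambda>s. \<Sum>l\<in>I. cis (of_int l * (2 * pi / \<tau>) * s) *\<^sub>C y l) k = y k"
proof -
  have "((\<lambda>s. \<Sum>l\<in>I. cis (of_int (l - k) * (2 * pi / \<tau>) * s) *\<^sub>C y l) has_integral
      (\<Sum>l\<in>I. if l - k = 0 then \<tau> *\<^sub>R y l else 0)) {0..\<tau>}"
    using I(1) \<tau> by (intro has_integral_sum has_integral_cis_scaleC)
  also have "(\<Sum>l\<in>I. if l - k = 0 then \<tau> *\<^sub>R y l else 0) = \<tau> *\<^sub>R y k"
    using I by (simp add: sum.delta)
  also have "(\<lambda>s. \<Sum>l\<in>I. cis (of_int (l - k) * (2 * pi / \<tau>) * s) *\<^sub>C y l) =
      (\<lambda>s. cis (- (of_int k * (2 * pi / \<tau>) * s)) *\<^sub>C (\<Sum>l\<in>I. cis (of_int l * (2 * pi / \<tau>) * s) *\<^sub>C y l))"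
  proof
    fix s
    have "of_int (l - k) * (2 * pi / \<tau>) * s =
        - (of_int k * (2 * pi / \<tau>) * s) + of_int l * (2 * pi / \<tau>) * s" for l
      by (simp add: left_diff_distrib diff_divide_distrib)
    then show "(\<Sum>l\<in>I. cis (of_int (l - k) * (2 * pi / \<tau>) * s) *\<^sub>C y l) =
        cis (- (of_int k * (2 * pi / \<tau>) * s)) *\<^sub>C (\<Sum>l\<in>I. cis (of_int l * (2 * pi / \<tau>) * s) *\<^sub>C y l)"
      by (simp only: scaleC_sum_right scaleC_scaleC cis_mult)
  qed
  finally show ?thesis
    unfolding fourier_coeff_def using \<tau> by (simp add: integral_unique)
qed

lemma has_integral_rinner_trig_sum:
  fixes u :: "real \<Rightarrow> 'a::complex_hilbert_space"
  assumes \<tau>: "\<tau> > 0" and u: "continuous_on {0..\<tau>} u" and I: "finite I"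
  shows "((\<lambda>s. rinner (u s) (\<Sum>k\<in>I. cis (of_int k * (2 * pi / \<tau>) * s) *\<^sub>C y k)) has_integral
      \<tau> * (\<Sum>k\<in>I. rinner (fourier_coeff \<tau> u k) (y k))) {0..\<tau>}"
proof -
  have "((\<lambda>s. rinner (u s) (cis (of_int k * (2 * pi / \<tau>) * s) *\<^sub>C y k)) has_integral
      \<tau> * rinner (fourier_coeff \<tau> u k) (y k)) {0..\<tau>}" for k
  proof -
    have "(\<lambda>s. cis (- (of_int k * (2 * pi / \<tau>) * s)) *\<^sub>C u s) integrable_on {0..\<tau>}"
      by (intro integrable_continuous_real continuous_intros continuous_on_cis u)
    then have "((\<lambda>s. cis (- (of_int k * (2 * pi / \<tau>) * s)) *\<^sub>C u s) has_integral
        \<tau> *\<^sub>R fourier_coeff \<tau> u k) {0..\<tau>}"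
      using \<tau> by (simp add: fourier_coeff_def has_integral_integral)
    from has_integral_linear[OF this rinner.bounded_linear_left[of "y k"]] show ?thesis
      by (simp add: o_def rinner_scaleC_right cis_cnj rinner_scaleR_left)
  qed
  then show ?thesis
    unfolding rinner.sum_right sum_distrib_left using I by (intro has_integral_sum)
qed

text \<open>The Fourier coefficients give the best approximation in the quadratic mean: Bessel's
  inequality is the case that \<open>y\<close> is the family of Fourier coefficients, and applied to a close
  approximation the identity yields Parseval's inequality.\<close>

lemma integral_dist_trig_sum:
  fixes u :: "real \<Rightarrow> 'a::complex_hilbert_space"
  assumes \<tau>: "\<tau> > 0" and u: "continuous_on {0..\<tau>} u" and I: "finite I"
  shows "((\<lambda>s. (norm (u s - (\<Sum>k\<in>I. cis (of_int k * (2 * pi / \<tau>) * s) *\<^sub>C y k)))\<^sup>2) has_integral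
      integral {0..\<tau>} (\<lambda>s. (norm (u s))\<^sup>2) - \<tau> * (\<Sum>k\<in>I. (norm (fourier_coeff \<tau> u k))\<^sup>2)
      + \<tau> * (\<Sum>k\<in>I. (norm (fourier_coeff \<tau> u k - y k))\<^sup>2)) {0..\<tau>}"
proof -
  let ?p = "\<lambda>s. \<Sum>k\<in>I. cis (of_int k * (2 * pi / \<tau>) * s) *\<^sub>C y k"
  have p: "continuous_on {0..\<tau>} ?p"
    by (intro continuous_intros continuous_on_cis)
  have 1: "((\<lambda>s. (norm (u s))\<^sup>2) has_integral integral {0..\<tau>} (\<lambda>s. (norm (u s))\<^sup>2)) {0..\<tau>}"
    by (intro integrable_integral integrable_continuous_real continuous_intros u)
  have 2: "((\<lambda>s. 2 * rinner (u s) (?p s)) has_integral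
      2 * (\<tau> * (\<Sum>k\<in>I. rinner (fourier_coeff \<tau> u k) (y k)))) {0..\<tau>}"
    by (intro has_integral_mult_right has_integral_rinner_trig_sum \<tau> u I)
  have 3: "((\<lambda>s. (norm (?p s))\<^sup>2) has_integral \<tau> * (\<Sum>k\<in>I. (norm (y k))\<^sup>2)) {0..\<tau>}"
    using has_integral_rinner_trig_sum[OF \<tau> p I, of y] fourier_coeff_trig_sum[OF \<tau> I, of _ y]
    by (simp add: rinner_self)
  have "integral {0..\<tau>} (\<lambda>s. (norm (u s))\<^sup>2)
      - 2 * (\<tau> * (\<Sum>k\<in>I. rinner (fourier_coeff \<tau> u k) (y k))) + \<tau> * (\<Sum>k\<in>I. (norm (y k))\<^sup>2)
    = integral {0..\<tau>} (\<lambda>s. (norm (u s))\<^sup>2) - \<tau> * (\<Sum>k\<in>I. (norm (fourier_coeff \<tau> u k))\<^sup>2)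
      + \<tau> * (\<Sum>k\<in>I. (norm (fourier_coeff \<tau> u k - y k))\<^sup>2)"
    by (simp add: norm_diff_square sum.distrib sum_subtractf algebra_simps flip: sum_distrib_left)
  then show ?thesis
    using has_integral_add[OF has_integral_diff[OF 1 2] 3] by (simp only: norm_diff_square)
qed

text \<open>This is the form in which Plancherel's theorem is used: a pointwise bound on Fourier
  coefficients becomes a bound in the quadratic mean. Parseval's inequality is needed for \<open>u\<close>
  only, which therefore is required to be continuous as a periodic function, while
  Bessel's inequality suffices for \<open>f\<close>.\<close>

theorem integral_norm_square_le_of_fourier_coeff_le:
  fixes u f :: "real \<Rightarrow> 'a::complex_hilbert_space"
  assumes \<tau>: "\<tau> > 0" and u: "continuous_on {0..\<tau>} u" "u \<tau> = u 0" and f: "continuous_on {0..\<tau>} f"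
    and le: "\<And>k. norm (fourier_coeff \<tau> u k) \<le> K * norm (fourier_coeff \<tau> f k)"
  shows "integral {0..\<tau>} (\<lambda>s. (norm (u s))\<^sup>2) \<le> K\<^sup>2 * integral {0..\<tau>} (\<lambda>s. (norm (f s))\<^sup>2)"
proof (rule field_le_epsilon)
  fix \<epsilon> :: real assume \<epsilon>: "\<epsilon> > 0"
  define e where "e = sqrt (\<epsilon> / \<tau>)"
  have e: "e > 0" "\<tau> * e\<^sup>2 = \<epsilon>"
    using \<epsilon> \<tau> by (simp_all add: e_def)
  obtain I y where I: "finite I" and
    y: "\<And>s. s \<in> {0..\<tau>} \<Longrightarrow> norm (u s - (\<Sum>k\<in>I. cis (of_int k * (2 * pi / \<tau>) * s) *\<^sub>C y k)) \<le> e"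
    by (rule periodic_imp_approx_trig_poly[OF \<tau> u e(1)]) blast
  have "integral {0..\<tau>} (\<lambda>s. (norm (u s))\<^sup>2) - \<tau> * (\<Sum>k\<in>I. (norm (fourier_coeff \<tau> u k))\<^sup>2)
      + \<tau> * (\<Sum>k\<in>I. (norm (fourier_coeff \<tau> u k - y k))\<^sup>2) \<le> measure lborel {0..\<tau>} *\<^sub>R e\<^sup>2"
    using power_mono[OF y norm_ge_zero, of _ 2]
    by (rule has_integral_le[OF integral_dist_trig_sum[OF \<tau> u(1) I, of y] has_integral_const_real])
  moreover have "0 \<le> \<tau> * (\<Sum>k\<in>I. (norm (fourier_coeff \<tau> u k - y k))\<^sup>2)"
    using \<tau> by (intro mult_nonneg_nonneg sum_nonneg) auto
  ultimately have "integral {0..\<tau>} (\<lambda>s. (norm (u s))\<^sup>2) \<le>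
      \<tau> * (\<Sum>k\<in>I. (norm (fourier_coeff \<tau> u k))\<^sup>2) + \<epsilon>"
    using \<tau> e(2) by simp
  also have "(\<Sum>k\<in>I. (norm (fourier_coeff \<tau> u k))\<^sup>2) \<le> (\<Sum>k\<in>I. K\<^sup>2 * (norm (fourier_coeff \<tau> f k))\<^sup>2)"
    by (intro sum_mono) (metis le norm_ge_zero power_mono power_mult_distrib)
  also have "\<tau> * (\<Sum>k\<in>I. K\<^sup>2 * (norm (fourier_coeff \<tau> f k))\<^sup>2) =
      K\<^sup>2 * (\<tau> * (\<Sum>k\<in>I. (norm (fourier_coeff \<tau> f k))\<^sup>2))"
    by (simp add: algebra_simps flip: sum_distrib_left)
  also have "\<tau> * (\<Sum>k\<in>I. (norm (fourier_coeff \<tau> f k))\<^sup>2) \<le> integral {0..\<tau>} (\<lambda>s. (norm (f s))\<^sup>2)"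
    using has_integral_nonneg[OF integral_dist_trig_sum[OF \<tau> f I, of "fourier_coeff \<tau> f"]] by simp
  finally show "integral {0..\<tau>} (\<lambda>s. (norm (u s))\<^sup>2) \<le>
      K\<^sup>2 * integral {0..\<tau>} (\<lambda>s. (norm (f s))\<^sup>2) + \<epsilon>"
    using \<tau> by (simp add: mult_left_mono)
qed

section \<open>Semigroups and resolvents\<close>

text \<open>Since the generator is \<open>- A\<close>, the operators that occur are the inverses \<open>R l\<close> of \<open>l + A\<close> for
  \<open>Re l > 0\<close>; up to sign they are the resolvents of \<open>A\<close> at the points \<open>- l\<close>.\<close>

locale exponential_semigroup =
  fixes T :: "real \<Rightarrow> 'a \<Rightarrow> 'a::complex_hilbert_space"
    and A :: "'a \<Rightarrow> 'a" and D :: "'a set" and \<omega> M\<^sub>\<omega> :: real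
  assumes semigroup: "C0_semigroup T"
    and generator: "is_generator D (\<lambda>x. - A x) T"
    and spectrum: "{l. Re l < 0} \<subseteq> resolvent_set D A"
    and omega: "\<omega> \<ge> 1" and M_omega: "M\<^sub>\<omega> \<ge> 1"
    and growth: "\<And>t. t \<ge> 0 \<Longrightarrow> onorm (T t) \<le> M\<^sub>\<omega> * exp (t * (\<omega> - 1))"
begin

abbreviation R :: "complex \<Rightarrow> 'a \<Rightarrow> 'a" where
  "R l \<equiv> inv_into D (\<lambda>x. l *\<^sub>C x + A x)"

lemma bounded_linear_T: "t \<ge> 0 \<Longrightarrow> bounded_linear (T t)"
  using semigroup by (simp add: C0_semigroup_def bounded_clinear_def)

lemma T_scaleC: "t \<ge> 0 \<Longrightarrow> T t (c *\<^sub>C x) = c *\<^sub>C T t x"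
  using semigroup by (simp add: C0_semigroup_def bounded_clinear_def)

lemma T_add: "s \<ge> 0 \<Longrightarrow> t \<ge> 0 \<Longrightarrow> T (s + t) x = T s (T t x)"
  using semigroup by (simp add: C0_semigroup_def)

lemma T_tendsto: "((\<lambda>t. T t x) \<longlongrightarrow> x) (at_right 0)"
  using semigroup by (simp add: C0_semigroup_def)

lemma norm_T_le: "t \<ge> 0 \<Longrightarrow> norm (T t x) \<le> onorm (T t) * norm x"
  by (rule onorm[OF bounded_linear_T])

lemma onorm_T_add_le: "s \<ge> 0 \<Longrightarrow> t \<ge> 0 \<Longrightarrow> onorm (T (s + t)) \<le> onorm (T s) * onorm (T t)"
  using onorm_compose[OF bounded_linear_T bounded_linear_T, of s t] semigroup
  by (simp add: C0_semigroup_def)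

lemma onorm_T_le_of_le:
  assumes "0 \<le> t" "t \<le> \<tau>"
  shows "onorm (T t) \<le> M\<^sub>\<omega> * exp (\<tau> * (\<omega> - 1))"
  using growth[OF assms(1)] M_omega omega assms
  by (elim order_trans) (intro mult_left_mono, auto intro: mult_right_mono)

lemma norm_T_le_of_le:
  assumes "0 \<le> t" "t \<le> \<tau>"
  shows "norm (T t x) \<le> (M\<^sub>\<omega> * exp (\<tau> * (\<omega> - 1))) * norm x"
  using norm_T_le[OF assms(1), of x] onorm_T_le_of_le[OF assms]
  by (meson mult_right_mono norm_ge_zero order_trans)

lemma continuous_on_T: "continuous_on {0..\<tau>} (\<lambda>t. T t x)"
proof -
  define N where "N = M\<^sub>\<omega> * exp (\<tau> * (\<omega> - 1))"
  have N: "N > 0"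
    using M_omega by (simp add: N_def)
  have est: "norm (T s x - T r x) \<le> N * norm (T (s - r) x - x)" if "0 \<le> r" "r \<le> s" "s \<le> \<tau>" for r s
  proof -
    have "T s x - T r x = T r (T (s - r) x - x)"
      using that T_add[of r "s - r" x] bounded_linear_T[of r]
      by (simp add: bounded_linear.linear linear_diff)
    then show ?thesis
      using norm_T_le_of_le[of r \<tau> "T (s - r) x - x"] that by (simp add: N_def)
  qed
  have "\<exists>d>0. \<forall>s\<in>{0..\<tau>}. \<forall>r\<in>{0..\<tau>}. dist r s < d \<longrightarrow> dist (T r x) (T s x) < \<epsilon>" if \<epsilon>: "\<epsilon> > 0" for \<epsilon>
  proof -
    have "eventually (\<lambda>h. dist (T h x) x < \<epsilon> / N) (at_right 0)"
      using T_tendsto N \<epsilon> by (intro tendstoD) auto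
    then obtain d where d: "d > 0" "\<And>h. 0 < h \<Longrightarrow> h < d \<Longrightarrow> norm (T h x - x) < \<epsilon> / N"
      unfolding eventually_at_right_field by (auto simp: dist_norm)
    have lt: "norm (T s x - T r x) < \<epsilon>" if "0 \<le> r" "r \<le> s" "s \<le> \<tau>" "s - r < d" for r s
    proof (cases "r = s")
      case False
      have "N * norm (T (s - r) x - x) < \<epsilon>"
        using d(2)[of "s - r"] that False N by (simp add: pos_less_divide_eq mult.commute)
      then show ?thesis
        using est[of r s] that by simp
    qed (use \<epsilon> in simp)
    have "dist (T r x) (T s x) < \<epsilon>" if "s \<in> {0..\<tau>}" "r \<in> {0..\<tau>}" "dist r s < d" for r s
      using lt[of r s] lt[of s r] that
      by (cases "r \<le> s") (auto simp: dist_norm norm_minus_commute)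
    then show ?thesis
      using d(1) by blast
  qed
  then show ?thesis
    by (intro uniformly_continuous_imp_continuous) (simp add: uniformly_continuous_on_def)
qed

lemma generator_tendsto: "y \<in> D \<Longrightarrow> ((\<lambda>h. (1 / h) *\<^sub>R (T h y - y)) \<longlongrightarrow> - A y) (at_right 0)"
  using generator by (simp add: is_generator_def)

lemma T_generator_commute:
  assumes y: "y \<in> D" and s: "s \<ge> 0"
  shows "T s y \<in> D" and "A (T s y) = T s (A y)"
proof -
  have "((\<lambda>h. T s ((1 / h) *\<^sub>R (T h y - y))) \<longlongrightarrow> T s (- A y)) (at_right 0)"
    by (rule bounded_linear.tendsto[OF bounded_linear_T[OF s] generator_tendsto[OF y]])
  moreover have "eventually (\<lambda>h. T s ((1 / h) *\<^sub>R (T h y - y)) = (1 / h) *\<^sub>R (T h (T s y) - T s y)) (at_right 0)"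
    unfolding eventually_at_right_field
    using s T_add[OF s] T_add[OF _ s] bounded_linear_T[OF s]
    by (intro exI[of _ 1]) (simp add: bounded_linear.linear linear_diff linear_scale add.commute[of _ s]
        flip: T_add)
  ultimately have lim: "((\<lambda>h. (1 / h) *\<^sub>R (T h (T s y) - T s y)) \<longlongrightarrow> T s (- A y)) (at_right 0)"
    by (rule Lim_transform_eventually)
  then show D: "T s y \<in> D"
    using generator by (auto simp: is_generator_def)
  have "- A (T s y) = T s (- A y)"
    by (rule tendsto_unique[OF _ generator_tendsto[OF D] lim]) simp
  then show "A (T s y) = T s (A y)"
    using bounded_linear_T[OF s] by (simp add: bounded_linear.linear linear_neg)
qed

text \<open>The generator describes increments to the right of \<open>0\<close> only. Every increment of the orbit
  between \<open>p \<le> q\<close> is \<open>T p\<close> applied to such an increment, which gives the derivative from the right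
  at \<open>p\<close>; for the derivative from the left at \<open>q\<close>, the operator \<open>T p\<close> is replaced by \<open>T q\<close> with
  strong continuity.\<close>

lemma T_has_vector_derivative:
  assumes y: "y \<in> D" and s: "s \<in> {0..\<tau>}"
  shows "((\<lambda>s. T s y) has_vector_derivative T s (- A y)) (at s within {0..\<tau>})"
proof -
  define N where "N = M\<^sub>\<omega> * exp (\<tau> * (\<omega> - 1))"
  have N: "N > 0"
    using M_omega by (simp add: N_def)
  have "\<exists>d>0. \<forall>r\<in>{0..\<tau>}. norm (r - s) < d \<longrightarrow>
      norm (T r y - T s y - (r - s) *\<^sub>R T s (- A y)) \<le> \<epsilon> * norm (r - s)" if \<epsilon>: "\<epsilon> > 0" for \<epsilon>
  proof -
    have "eventually (\<lambda>h. dist ((1 / h) *\<^sub>R (T h y - y)) (- A y) < \<epsilon> / (2 * N)) (at_right 0)"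
      using generator_tendsto[OF y] N \<epsilon> by (intro tendstoD) auto
    then obtain d1 where d1: "d1 > 0"
      "\<And>h. 0 < h \<Longrightarrow> h < d1 \<Longrightarrow> norm ((1 / h) *\<^sub>R (T h y - y) - (- A y)) < \<epsilon> / (2 * N)"
      unfolding eventually_at_right_field by (auto simp: dist_norm)
    obtain d2 where d2: "d2 > 0"
      "\<And>r. r \<in> {0..\<tau>} \<Longrightarrow> dist r s < d2 \<Longrightarrow> dist (T r (- A y)) (T s (- A y)) < \<epsilon> / 2"
      using continuous_on_T[of \<tau> "- A y"] s \<epsilon> unfolding continuous_on_iff by (meson half_gt_zero)
    have est: "norm (T q y - T p y - (q - p) *\<^sub>R T p (- A y)) \<le> \<epsilon> / 2 * (q - p)"
      if "0 \<le> p" "p \<le> q" "q \<le> \<tau>" "q - p < d1" for p q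
    proof (cases "p = q")
      case False
      define h where "h = q - p"
      have h: "h > 0" "h < d1"
        using that False by (auto simp: h_def)
      have "T q y - T p y - h *\<^sub>R T p (- A y) = h *\<^sub>R T p ((1 / h) *\<^sub>R (T h y - y) - (- A y))"
        using that(1) h T_add[of p h y] bounded_linear_T[of p]
        by (simp add: bounded_linear.linear linear_diff linear_add linear_neg linear_scale h_def algebra_simps)
      also have "norm \<dots> \<le> h * (N * norm ((1 / h) *\<^sub>R (T h y - y) - (- A y)))"
        using norm_T_le_of_le[of p \<tau>, folded N_def] that h(1) by simp
      also have "\<dots> \<le> h * (N * (\<epsilon> / (2 * N)))"
        using d1(2)[OF h] h(1) N by (intro mult_left_mono) auto
      finally show ?thesis
        using N by (simp add: h_def mult.commute)
    qed simp
    have "norm (T r y - T s y - (r - s) *\<^sub>R T s (- A y)) \<le> \<epsilon> * norm (r - s)"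
      if r: "r \<in> {0..\<tau>}" "norm (r - s) < min d1 d2" for r
    proof (cases "s \<le> r")
      case True
      have "\<epsilon> / 2 * (r - s) \<le> \<epsilon> * (r - s)"
        using True \<epsilon> by (intro mult_right_mono) auto
      then show ?thesis
        using est[of s r] r s True by auto
    next
      case False
      have "T r y - T s y - (r - s) *\<^sub>R T s (- A y) =
          (s - r) *\<^sub>R (T s (- A y) - T r (- A y)) - (T s y - T r y - (s - r) *\<^sub>R T r (- A y))"
        by (simp add: algebra_simps)
      also have "norm \<dots> \<le> norm ((s - r) *\<^sub>R (T s (- A y) - T r (- A y)))
          + norm (T s y - T r y - (s - r) *\<^sub>R T r (- A y))"
        by (rule norm_triangle_ineq4)
      also have "\<dots> \<le> (s - r) * (\<epsilon> / 2) + \<epsilon> / 2 * (s - r)"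
      proof (intro add_mono)
        have "norm (T s (- A y) - T r (- A y)) \<le> \<epsilon> / 2"
          using d2(2)[of r] r by (auto simp: dist_norm norm_minus_commute)
        from mult_left_mono[OF this, of "s - r"]
        show "norm ((s - r) *\<^sub>R (T s (- A y) - T r (- A y))) \<le> (s - r) * (\<epsilon> / 2)"
          using False by simp
        show "norm (T s y - T r y - (s - r) *\<^sub>R T r (- A y)) \<le> \<epsilon> / 2 * (s - r)"
          using est[of r s] r s False by auto
      qed
      finally show ?thesis
        using False by (simp add: algebra_simps)
    qed
    then show ?thesis
      using d1(1) d2(1) by (intro exI[of _ "min d1 d2"]) auto
  qed
  then show ?thesis
    unfolding has_vector_derivative_def has_derivative_within_alt
    by (simp add: bounded_linear_scaleR_left)
qed

lemma
  assumes "Re l > 0"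
  shows resolvent_bij: "bij_betw (\<lambda>x. l *\<^sub>C x + A x) D UNIV"
    and bounded_clinear_resolvent: "bounded_clinear (R l)"
proof -
  let ?f = "\<lambda>x. l *\<^sub>C x + A x" and ?g = "\<lambda>x. (- l) *\<^sub>C x - A x"
  have g_eq: "?g = uminus \<circ> ?f"
    by (simp add: fun_eq_iff scaleC_uminus_left)
  have "- l \<in> resolvent_set D A"
    using spectrum assms by auto
  then have g: "bij_betw ?g D UNIV" "bounded_clinear (inv_into D ?g)"
    by (simp_all add: resolvent_set_def)
  have f_eq: "?f = uminus \<circ> ?g"
    by (simp add: fun_eq_iff g_eq)
  have "bij_betw uminus UNIV (UNIV :: 'a set)"
    by (rule bij_uminus)
  from bij_betw_trans[OF g(1) this] show f: "bij_betw ?f D UNIV"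
    by (simp only: f_eq)
  have R_eq: "R l = inv_into D ?g \<circ> uminus"
  proof
    fix x
    define z where "z = inv_into D ?g (- x)"
    have z: "z \<in> D" "?g z = - x"
      using bij_betw_inv_into_right[OF g(1), of "- x"] inv_into_into[of "- x" ?g D]
        bij_betw_imp_surj_on[OF g(1)]
      by (simp_all only: z_def UNIV_I)
    have "?f z = x"
      using z(2) fun_cong[OF g_eq, of z] by (simp only: o_apply neg_equal_iff_equal)
    then show "R l x = (inv_into D ?g \<circ> uminus) x"
      using f z(1) by (simp add: bij_betw_def inv_into_f_eq z_def[symmetric])
  qed
  define h where "h = inv_into D ?g"
  have h: "bounded_linear h" "\<And>c x. h (c *\<^sub>C x) = c *\<^sub>C h x"
    using g(2) by (simp_all only: h_def bounded_clinear_def)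
  have "bounded_linear (\<lambda>x. h (- x))"
    by (rule bounded_linear_compose[OF h(1) bounded_linear_minus[OF bounded_linear_ident]])
  moreover have "h (- (c *\<^sub>C x)) = c *\<^sub>C h (- x)" for c x
    by (metis h(2) bounded_bilinear.minus_right[OF bounded_bilinear_scaleC])
  ultimately show "bounded_clinear (R l)"
    by (simp add: R_eq bounded_clinear_def o_def flip: h_def)
qed

lemma resolvent_in_domain:
  assumes "Re l > 0"
  shows "R l x \<in> D" and "l *\<^sub>C R l x + A (R l x) = x"
  using bij_betw_inv_into_right[OF resolvent_bij[OF assms], of x]
    inv_into_into[of x "\<lambda>x. l *\<^sub>C x + A x" D] bij_betw_imp_surj_on[OF resolvent_bij[OF assms]]
  by (simp_all only: UNIV_I)

lemma T_resolvent_commute: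
  assumes l: "Re l > 0" and s: "s \<ge> 0"
  shows "T s (R l x) = R l (T s x)"
proof -
  note y = resolvent_in_domain[OF l, of x]
  have "l *\<^sub>C T s (R l x) + A (T s (R l x)) = T s (l *\<^sub>C R l x + A (R l x))"
    using bounded_linear_T[OF s] T_generator_commute(2)[OF y(1) s]
    by (simp add: bounded_linear.linear linear_add T_scaleC s)
  also have "\<dots> = T s x"
    by (simp only: y(2))
  finally show ?thesis
    by (rule inv_into_f_eq[OF bij_betw_imp_inj_on[OF resolvent_bij[OF l]]
          T_generator_commute(1)[OF y(1) s], symmetric])
qed

text \<open>Write \<open>x = (l + A) y\<close> with \<open>y = R l x\<close>. Then \<open>\<phi> s * exp (- l s) *\<^sub>C T s y\<close> has the derivative
  \<open>\<phi>' s * exp (- l s) *\<^sub>C T s y - \<phi> s * exp (- l s) *\<^sub>C T s x\<close>, whose integral vanishes because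
  \<open>\<phi>\<close> vanishes at both ends. Hence a cutoff of an orbit is the resolvent applied to the
  orbit weighted with the derivative of the cutoff, after integration against an exponential.\<close>

lemma integral_cutoff_orbit:
  assumes l: "Re l > 0" and \<tau>: "\<tau> > 0"
    and \<phi>: "\<And>s. s \<in> {0..\<tau>} \<Longrightarrow> (\<phi> has_real_derivative \<phi>' s) (at s within {0..\<tau>})"
    and \<phi>': "continuous_on {0..\<tau>} \<phi>'" and ends: "\<phi> 0 = 0" "\<phi> \<tau> = 0"
  shows "integral {0..\<tau>} (\<lambda>s. (complex_of_real (\<phi> s) * exp (- l * complex_of_real s)) *\<^sub>C T s x) =
    R l (integral {0..\<tau>} (\<lambda>s. (complex_of_real (\<phi>' s) * exp (- l * complex_of_real s)) *\<^sub>C T s x))"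
    (is "integral _ ?F = R l (integral _ ?G)")
proof -
  define y where "y = R l x"
  have y: "y \<in> D" "l *\<^sub>C y + A y = x"
    using resolvent_in_domain[OF l] by (simp_all add: y_def)
  define m where "m s = complex_of_real (\<phi> s) * exp (- l * complex_of_real s)" for s
  have \<phi>_cont: "continuous_on {0..\<tau>} \<phi>"
    using \<phi> by (meson DERIV_continuous continuous_on_eq_continuous_within)
  have R: "bounded_linear (R l)" "\<And>c x. R l (c *\<^sub>C x) = c *\<^sub>C R l x"
    using bounded_clinear_resolvent[OF l] by (simp_all add: bounded_clinear_def)
  have "((\<lambda>s. R l (?G s) - ?F s) has_integral (m \<tau> *\<^sub>C T \<tau> y - m 0 *\<^sub>C T 0 y)) {0..\<tau>}"
  proof (rule fundamental_theorem_of_calculus)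
    fix s assume s: "s \<in> {0..\<tau>}"
    have "((\<lambda>s. complex_of_real (\<phi> s)) has_vector_derivative complex_of_real (\<phi>' s)) (at s within {0..\<tau>})"
      using \<phi>[OF s] by (simp add: has_vector_derivative_of_real has_real_derivative_iff_has_vector_derivative)
    from has_vector_derivative_mult[OF this exp_has_vector_derivative[of "- l"]]
    have "(m has_vector_derivative (complex_of_real (\<phi> s) * (- l * exp (- l * complex_of_real s)) +
        complex_of_real (\<phi>' s) * exp (- l * complex_of_real s))) (at s within {0..\<tau>})"
      unfolding m_def .
    from bounded_bilinear.has_vector_derivative[OF bounded_bilinear_scaleC this T_has_vector_derivative[OF y(1) s]]
    have "((\<lambda>s. m s *\<^sub>C T s y) has_vector_derivative m s *\<^sub>C T s (- A y) +
        (complex_of_real (\<phi> s) * (- l * exp (- l * complex_of_real s)) +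
        complex_of_real (\<phi>' s) * exp (- l * complex_of_real s)) *\<^sub>C T s y) (at s within {0..\<tau>})" .
    moreover have "m s *\<^sub>C T s (- A y) + (complex_of_real (\<phi> s) * (- l * exp (- l * complex_of_real s)) +
        complex_of_real (\<phi>' s) * exp (- l * complex_of_real s)) *\<^sub>C T s y = R l (?G s) - ?F s"
    proof -
      have "T s x = l *\<^sub>C T s y + T s (A y)" "T s (- A y) = - T s (A y)"
        using s bounded_linear_T[of s] unfolding y(2)[symmetric]
        by (simp_all add: bounded_linear.linear linear_add linear_neg T_scaleC)
      moreover have Rx: "R l (T s x) = T s y"
        using T_resolvent_commute[OF l, of s x] s by (simp add: y_def)
      moreover have "R l (?G s) = (complex_of_real (\<phi>' s) * exp (- l * complex_of_real s)) *\<^sub>C T s y"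
        by (simp only: R(2) Rx)
      ultimately show ?thesis
        by (simp only: m_def scaleC_add_left scaleC_add_right scaleC_scaleC)
          (simp add: scaleC_uminus_left bounded_bilinear.minus_right[OF bounded_bilinear_scaleC]
            mult.commute mult.left_commute)
    qed
    ultimately show "((\<lambda>s. m s *\<^sub>C T s y) has_vector_derivative R l (?G s) - ?F s) (at s within {0..\<tau>})"
      by simp
  qed (use \<tau> in simp)
  also have "m \<tau> *\<^sub>C T \<tau> y - m 0 *\<^sub>C T 0 y = 0"
    using ends by (simp add: m_def bounded_bilinear.zero_left[OF bounded_bilinear_scaleC])
  finally have 1: "((\<lambda>s. R l (?G s) - ?F s) has_integral 0) {0..\<tau>}" .
  have "?F integrable_on {0..\<tau>}" "?G integrable_on {0..\<tau>}"
    by (intro integrable_continuous_real continuous_intros continuous_on_T \<phi>_cont \<phi>')+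
  then have "((\<lambda>s. R l (?G s) - ?F s) has_integral (R l (integral {0..\<tau>} ?G) - integral {0..\<tau>} ?F)) {0..\<tau>}"
    using has_integral_linear[OF integrable_integral R(1), of ?G] by (intro has_integral_diff) (auto simp: o_def)
  from has_integral_unique[OF this 1] show ?thesis
    by simp
qed

text \<open>The points \<open>c + \<i> * k * 2 * pi / \<tau>\<close> turn the preceding identity into a relation between the
  Fourier coefficients of the two weighted orbits on the interval from \<open>0\<close> to \<open>\<tau>\<close>.\<close>

lemma integral_cutoff_orbit_le:
  assumes c: "c > 0" and K: "\<And>l. Re l = c \<Longrightarrow> onorm (R l) \<le> K" and \<tau>: "\<tau> > 0"
    and \<phi>: "\<And>s. s \<in> {0..\<tau>} \<Longrightarrow> (\<phi> has_real_derivative \<phi>' s) (at s within {0..\<tau>})"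
    and \<phi>': "continuous_on {0..\<tau>} \<phi>'" and ends: "\<phi> 0 = 0" "\<phi> \<tau> = 0"
  shows "integral {0..\<tau>} (\<lambda>s. (\<phi> s * (exp (- c * s) * norm (T s x)))\<^sup>2) \<le>
    K\<^sup>2 * integral {0..\<tau>} (\<lambda>s. (\<phi>' s * (exp (- c * s) * norm (T s x)))\<^sup>2)"
proof -
  define u where "u s = (\<phi> s * exp (- c * s)) *\<^sub>R T s x" for s
  define f where "f s = (\<phi>' s * exp (- c * s)) *\<^sub>R T s x" for s
  have \<phi>_cont: "continuous_on {0..\<tau>} \<phi>"
    using \<phi> by (meson DERIV_continuous continuous_on_eq_continuous_within)
  have cont: "continuous_on {0..\<tau>} u" "continuous_on {0..\<tau>} f"
    unfolding u_def f_def by (intro continuous_intros continuous_on_T \<phi>_cont \<phi>')+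
  have "norm (fourier_coeff \<tau> u k) \<le> K * norm (fourier_coeff \<tau> f k)" for k
  proof -
    define l where "l = Complex c (of_int k * (2 * pi / \<tau>))"
    have l: "Re l = c" "Re l > 0"
      using c by (simp_all add: l_def)
    have "cis (- (of_int k * (2 * pi / \<tau>) * s)) * complex_of_real (exp (- c * s)) = exp (- l * complex_of_real s)" for s
      by (simp add: cis_conv_exp l_def exp_of_real[symmetric] exp_add[symmetric] Complex_eq algebra_simps)
    then have eq: "cis (- (of_int k * (2 * pi / \<tau>) * s)) *\<^sub>C ((b * exp (- c * s)) *\<^sub>R T s x) =
        (complex_of_real b * exp (- l * complex_of_real s)) *\<^sub>C T s x" for b s
      by (simp add: scaleC_scaleC mult.assoc mult.left_commute flip: scaleC_of_real)
    have R: "bounded_linear (R l)"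
      using bounded_clinear_resolvent[OF l(2)] by (simp add: bounded_clinear_def)
    have "fourier_coeff \<tau> u k = R l (fourier_coeff \<tau> f k)"
      using integral_cutoff_orbit[OF l(2) \<tau> \<phi> \<phi>' ends, of x] R
      unfolding fourier_coeff_def u_def f_def eq by (simp add: bounded_linear.linear linear_scale)
    then have "norm (fourier_coeff \<tau> u k) \<le> onorm (R l) * norm (fourier_coeff \<tau> f k)"
      using onorm[OF R] by simp
    also have "\<dots> \<le> K * norm (fourier_coeff \<tau> f k)"
      using K[OF l(1)] by (intro mult_right_mono) auto
    finally show ?thesis .
  qed
  from integral_norm_square_le_of_fourier_coeff_le[OF \<tau> cont(1) _ cont(2) this]
  show ?thesis
    using ends by (simp add: u_def f_def power_mult_distrib mult.assoc)
qed

end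

section \<open>From resolvent bounds on a half-plane to semigroup bounds\<close>

context exponential_semigroup
begin

text \<open>The cutoff \<open>(1 - exp (- \<omega> * s)) * (1 - s / \<tau>)\<close> makes both sides of the inequality for
  cutoffs explicit: near \<open>0\<close> its derivative contributes \<open>\<omega> * exp (- \<omega> * s)\<close>, which compensates
  the a priori growth of the semigroup, and the contribution of the linear factor disappears as
  \<open>\<tau>\<close> tends to infinity, provided that the rescaled semigroup is known to be bounded. The
  resulting bound does not depend on the bound \<open>N\<close> that was assumed.\<close>

lemma integral_orbit_le:
  assumes c: "c > 0" and K: "\<And>l. Re l = c \<Longrightarrow> onorm (R l) \<le> K"
    and N: "\<And>s. s \<ge> 0 \<Longrightarrow> onorm (T s) \<le> N * exp (c * s)"
    and p: "1 \<le> p" "p \<le> t"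
  shows "integral {p..t} (\<lambda>s. (exp (- c * s) * norm (T s x))\<^sup>2) \<le> (2 * K * \<omega> * M\<^sub>\<omega> * norm x)\<^sup>2"
proof -
  define h where "h s = exp (- c * s) * norm (T s x)" for s
  have h_nonneg: "h s \<ge> 0" for s
    by (simp add: h_def)
  have h_cont: "continuous_on {0..\<tau>} h" for \<tau>
    unfolding h_def by (intro continuous_intros continuous_on_T)
  have h_le: "h s \<le> N * norm x" "exp (- \<omega> * s) * h s \<le> exp (- s) * (M\<^sub>\<omega> * norm x)" if s: "s \<ge> 0" for s
  proof -
    have "norm (T s x) \<le> N * exp (c * s) * norm x"
      using norm_T_le[OF s, of x] N[OF s] by (meson mult_right_mono norm_ge_zero order_trans)
    then have "h s \<le> exp (- c * s) * (N * exp (c * s) * norm x)"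
      unfolding h_def by (intro mult_left_mono) auto
    also have "\<dots> = (exp (- c * s) * exp (c * s)) * (N * norm x)"
      by (simp only: mult_ac)
    also have "exp (- c * s) * exp (c * s) = 1"
      by (simp flip: exp_add)
    finally show "h s \<le> N * norm x"
      by simp
    have "h s \<le> 1 * norm (T s x)"
      unfolding h_def using c s by (intro mult_right_mono) auto
    also have "\<dots> \<le> M\<^sub>\<omega> * exp (s * (\<omega> - 1)) * norm x"
      using norm_T_le[OF s, of x] growth[OF s] by (simp, meson mult_right_mono norm_ge_zero order_trans)
    finally have "exp (- \<omega> * s) * h s \<le> exp (- \<omega> * s) * (M\<^sub>\<omega> * exp (s * (\<omega> - 1)) * norm x)"
      by (intro mult_left_mono) auto
    also have "\<dots> = (exp (- \<omega> * s) * exp (s * (\<omega> - 1))) * (M\<^sub>\<omega> * norm x)"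
      by (simp only: mult_ac)
    also have "exp (- \<omega> * s) * exp (s * (\<omega> - 1)) = exp (- s)"
      by (simp add: algebra_simps flip: exp_add)
    finally show "exp (- \<omega> * s) * h s \<le> exp (- s) * (M\<^sub>\<omega> * norm x)" .
  qed
  let ?J = "integral {p..t} (\<lambda>s. (h s)\<^sup>2)"
  have est: "(1 - t / \<tau>)\<^sup>2 * ?J \<le> 4 * (K\<^sup>2 * (\<omega>\<^sup>2 * (M\<^sub>\<omega> * norm x)\<^sup>2 + 2 * (N * norm x)\<^sup>2 / \<tau>))"
    if \<tau>: "\<tau> > t" for \<tau>
  proof -
    have \<tau>0: "\<tau> > 0"
      using \<tau> p by simp
    define \<phi> where "\<phi> s = (1 - exp (- \<omega> * s)) * (1 - s / \<tau>)" for s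
    define \<phi>' where "\<phi>' s = \<omega> * exp (- \<omega> * s) * (1 - s / \<tau>) - (1 - exp (- \<omega> * s)) / \<tau>" for s
    have \<phi>_deriv: "(\<phi> has_real_derivative \<phi>' s) (at s within {0..\<tau>})" for s
      unfolding \<phi>_def \<phi>'_def using \<tau>0 by (auto intro!: derivative_eq_intros simp: field_simps)
    have \<phi>_cont: "continuous_on S \<phi>" "continuous_on S \<phi>'" for S
      unfolding \<phi>_def \<phi>'_def using \<tau>0 by (auto intro!: continuous_intros)
    have int: "(\<lambda>s. (\<phi> s * h s)\<^sup>2) integrable_on {0..\<tau>}" "(\<lambda>s. (\<phi>' s * h s)\<^sup>2) integrable_on {0..\<tau>}"
      by (intro integrable_continuous_real continuous_intros \<phi>_cont h_cont)+
    \<comment> \<open>On the window the first factor of the cutoff is at least \<open>1 - exp (- 1) \<ge> 1 / 2\<close>, because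
      \<open>p \<ge> 1\<close> and \<open>\<omega> \<ge> 1\<close>.\<close>
    have lower: "((1 - t / \<tau>) / 2)\<^sup>2 * (h s)\<^sup>2 \<le> (\<phi> s * h s)\<^sup>2" if s: "s \<in> {p..t}" for s
    proof -
      have "1 * 1 \<le> \<omega> * s"
        using s p omega by (intro mult_mono) auto
      then have "exp (- \<omega> * s) \<le> exp (- 1)"
        by simp
      also have "exp (- 1) \<le> (1 / 2 :: real)"
        using exp_ge_add_one_self[of "1::real"] by (simp add: exp_minus field_simps)
      finally have "1 / 2 * (1 - t / \<tau>) \<le> \<phi> s"
        unfolding \<phi>_def using s p omega \<tau> \<tau>0 by (intro mult_mono) (auto simp: divide_right_mono)
      then have "(1 - t / \<tau>) / 2 * h s \<le> \<phi> s * h s"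
        using h_nonneg by (intro mult_right_mono) auto
      moreover have "0 \<le> (1 - t / \<tau>) / 2 * h s"
        using \<tau> \<tau>0 h_nonneg[of s] by simp
      ultimately have "((1 - t / \<tau>) / 2 * h s)\<^sup>2 \<le> (\<phi> s * h s)\<^sup>2"
        by (rule power_mono)
      then show ?thesis
        by (simp only: power_mult_distrib)
    qed
    have upper: "(\<phi>' s * h s)\<^sup>2 \<le> 2 * (\<omega>\<^sup>2 * (M\<^sub>\<omega> * norm x)\<^sup>2) * exp (- 2 * s) + 2 * ((N * norm x)\<^sup>2 / \<tau>\<^sup>2)"
      if s: "s \<in> {0..\<tau>}" for s
    proof -
      define a where "a = \<omega> * exp (- \<omega> * s) * (1 - s / \<tau>) * h s"
      define b where "b = (1 - exp (- \<omega> * s)) / \<tau> * h s"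
      have pos: "0 \<le> 1 - s / \<tau>" "1 - s / \<tau> \<le> 1" "0 \<le> 1 - exp (- \<omega> * s)" "1 - exp (- \<omega> * s) \<le> 1" "0 \<le> \<omega>"
        using s \<tau>0 omega by auto
      have "a = (1 - s / \<tau>) * (\<omega> * (exp (- \<omega> * s) * h s))"
        by (simp add: a_def)
      also have "\<dots> \<le> 1 * (\<omega> * (exp (- \<omega> * s) * h s))"
        using pos h_nonneg[of s] by (intro mult_right_mono) auto
      also have "\<dots> \<le> 1 * (\<omega> * (exp (- s) * (M\<^sub>\<omega> * norm x)))"
        using pos s by (intro mult_left_mono h_le(2)) auto
      finally have "a\<^sup>2 \<le> (\<omega> * (exp (- s) * (M\<^sub>\<omega> * norm x)))\<^sup>2"
        using pos h_nonneg[of s] by (intro power_mono) (auto simp: a_def)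
      also have "(exp (- s))\<^sup>2 = exp (- 2 * s)"
        by (simp add: power2_eq_square flip: exp_add)
      then have "(\<omega> * (exp (- s) * (M\<^sub>\<omega> * norm x)))\<^sup>2 = \<omega>\<^sup>2 * (M\<^sub>\<omega> * norm x)\<^sup>2 * exp (- 2 * s)"
        by (simp only: power_mult_distrib mult_ac)
      finally have a: "a\<^sup>2 \<le> \<omega>\<^sup>2 * (M\<^sub>\<omega> * norm x)\<^sup>2 * exp (- 2 * s)" .
      have "b \<le> 1 / \<tau> * (N * norm x)"
        unfolding b_def using pos s h_nonneg[of s] h_le(1)[of s] \<tau>0
        by (intro mult_mono divide_right_mono) auto
      then have "b\<^sup>2 \<le> (1 / \<tau> * (N * norm x))\<^sup>2"
        using pos h_nonneg[of s] \<tau>0 by (intro power_mono) (auto simp: b_def)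
      then have b: "b\<^sup>2 \<le> (N * norm x)\<^sup>2 / \<tau>\<^sup>2"
        by (simp add: power_divide)
      have "(\<phi>' s * h s)\<^sup>2 = (a - b)\<^sup>2"
        by (simp add: \<phi>'_def a_def b_def left_diff_distrib)
      also have "\<dots> \<le> 2 * a\<^sup>2 + 2 * b\<^sup>2"
        using zero_le_power2[of "a + b"] by (simp add: power2_sum power2_diff)
      finally show ?thesis
        using a b by simp
    qed
    have exp_int: "((\<lambda>s. exp (- 2 * s)) has_integral (1 - exp (- 2 * \<tau>)) / 2) {0..\<tau>}"
    proof -
      have "((\<lambda>s. exp (- 2 * s)) has_integral (- exp (- 2 * \<tau>) / 2 - - exp (- 2 * 0) / 2)) {0..\<tau>}"
        using \<tau>0 by (intro fundamental_theorem_of_calculus)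
          (auto intro!: derivative_eq_intros simp flip: has_real_derivative_iff_has_vector_derivative)
      then show ?thesis
        by (simp add: field_simps)
    qed
    have "((1 - t / \<tau>) / 2)\<^sup>2 * ?J = integral {p..t} (\<lambda>s. ((1 - t / \<tau>) / 2)\<^sup>2 * (h s)\<^sup>2)"
      by simp
    also have "\<dots> \<le> integral {p..t} (\<lambda>s. (\<phi> s * h s)\<^sup>2)"
    proof (rule integral_le)
      show "(\<lambda>s. ((1 - t / \<tau>) / 2)\<^sup>2 * (h s)\<^sup>2) integrable_on {p..t}" "(\<lambda>s. (\<phi> s * h s)\<^sup>2) integrable_on {p..t}"
        using p
        by (intro integrable_continuous_real continuous_intros \<phi>_cont continuous_on_subset[OF h_cont[of t]]; force)+
    qed (rule lower)
    also have "\<dots> \<le> integral {0..\<tau>} (\<lambda>s. (\<phi> s * h s)\<^sup>2)"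
      using p \<tau> by (intro integral_subset_le int(1) integrable_subinterval_real[OF int(1)]) auto
    also have "\<dots> \<le> K\<^sup>2 * integral {0..\<tau>} (\<lambda>s. (\<phi>' s * h s)\<^sup>2)"
      unfolding h_def
      by (rule integral_cutoff_orbit_le[OF c K \<tau>0 \<phi>_deriv \<phi>_cont(2)]) (use \<tau>0 in \<open>auto simp: \<phi>_def\<close>)
    also have "\<dots> \<le> K\<^sup>2 * (\<omega>\<^sup>2 * (M\<^sub>\<omega> * norm x)\<^sup>2 + 2 * (N * norm x)\<^sup>2 / \<tau>)"
    proof (rule mult_left_mono)
      have "integral {0..\<tau>} (\<lambda>s. (\<phi>' s * h s)\<^sup>2) \<le>
          2 * (\<omega>\<^sup>2 * (M\<^sub>\<omega> * norm x)\<^sup>2) * ((1 - exp (- 2 * \<tau>)) / 2)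
            + measure lborel {0..\<tau>} *\<^sub>R (2 * ((N * norm x)\<^sup>2 / \<tau>\<^sup>2))"
        using upper by (intro has_integral_le[OF integrable_integral[OF int(2)]
            has_integral_add[OF has_integral_mult_right[OF exp_int] has_integral_const_real]])
      also have "measure lborel {0..\<tau>} *\<^sub>R (2 * ((N * norm x)\<^sup>2 / \<tau>\<^sup>2)) = 2 * (N * norm x)\<^sup>2 / \<tau>"
        using \<tau>0 by (simp add: power2_eq_square[of \<tau>])
      also have "2 * (\<omega>\<^sup>2 * (M\<^sub>\<omega> * norm x)\<^sup>2) * ((1 - exp (- 2 * \<tau>)) / 2)
          = \<omega>\<^sup>2 * (M\<^sub>\<omega> * norm x)\<^sup>2 * (1 - exp (- 2 * \<tau>))"
        by simp
      also have "\<dots> \<le> \<omega>\<^sup>2 * (M\<^sub>\<omega> * norm x)\<^sup>2"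
        by (intro mult_left_le) auto
      finally show "integral {0..\<tau>} (\<lambda>s. (\<phi>' s * h s)\<^sup>2) \<le> \<omega>\<^sup>2 * (M\<^sub>\<omega> * norm x)\<^sup>2 + 2 * (N * norm x)\<^sup>2 / \<tau>"
        by simp
    qed simp
    finally show ?thesis
      by (simp add: power_divide mult.commute[of _ 4])
  qed
  have lim1: "((\<lambda>\<tau>. (1 - t / \<tau>)\<^sup>2 * ?J) \<longlongrightarrow> (1 - 0)\<^sup>2 * ?J) at_top"
    by (intro tendsto_intros tendsto_divide_0[OF tendsto_const] filterlim_at_top_imp_at_infinity filterlim_ident)
  have lim2: "((\<lambda>\<tau>. 4 * (K\<^sup>2 * (\<omega>\<^sup>2 * (M\<^sub>\<omega> * norm x)\<^sup>2 + 2 * (N * norm x)\<^sup>2 / \<tau>))) \<longlongrightarrow>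
      4 * (K\<^sup>2 * (\<omega>\<^sup>2 * (M\<^sub>\<omega> * norm x)\<^sup>2 + 0))) at_top"
    by (intro tendsto_intros tendsto_divide_0[OF tendsto_const] filterlim_at_top_imp_at_infinity filterlim_ident)
  have "(1 - 0)\<^sup>2 * ?J \<le> 4 * (K\<^sup>2 * (\<omega>\<^sup>2 * (M\<^sub>\<omega> * norm x)\<^sup>2 + 0))"
    by (intro tendsto_le[OF trivial_limit_at_top_linorder lim2 lim1]
        eventually_mono[OF eventually_gt_at_top[of t]] est)
  then show ?thesis
    by (simp add: h_def power_mult_distrib mult_ac)
qed

lemma onorm_T_nonneg: "t \<ge> 0 \<Longrightarrow> 0 \<le> onorm (T t)"
  by (rule onorm_pos_le[OF bounded_linear_T])

text \<open>The bound in the quadratic mean on a window of length one before \<open>t\<close> gives a bound at \<open>t\<close>,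
  because the semigroup is bounded by \<open>M\<close> on times up to one. Times \<open>t \<le> 2\<close>, for which the
  window comes too close to \<open>0\<close>, are covered by \<open>M\<close> directly.\<close>

lemma onorm_T_le:
  assumes c: "c > 0" and K: "\<And>l. Re l = c \<Longrightarrow> onorm (R l) \<le> K" and K0: "K \<ge> 0"
    and N: "\<And>s. s \<ge> 0 \<Longrightarrow> onorm (T s) \<le> N * exp (c * s)"
    and M: "\<And>s. s \<in> {0..2} \<Longrightarrow> onorm (T s) \<le> M"
    and t: "t \<ge> 0"
  shows "onorm (T t) \<le> M\<^sub>\<omega> * (1 + 2 * M * \<omega>) * (K + 1) * exp (c * t)"
proof -
  have M0: "M \<ge> 0"
    using M[of 0] onorm_T_nonneg[of 0] by simp
  define C where "C = M\<^sub>\<omega> * (1 + 2 * M * \<omega>) * (K + 1)"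
  have "M * 1 \<le> M * \<omega>"
    using omega M0 by (intro mult_left_mono) auto
  then have MC: "M \<le> 1 + 2 * M * \<omega>"
    using M0 by linarith
  then have "1 * M * 1 \<le> C"
    unfolding C_def using M_omega K0 M0 by (intro mult_mono) auto
  moreover have "M\<^sub>\<omega> * (2 * M * \<omega>) * K \<le> C"
    unfolding C_def using M_omega K0 M0 omega by (intro mult_mono) auto
  ultimately have C: "M \<le> C" "2 * M * K * \<omega> * M\<^sub>\<omega> \<le> C"
    by (simp_all add: mult_ac)
  show ?thesis
  proof (cases "t \<le> 2")
    case True
    have "M * 1 \<le> C * exp (c * t)"
      using C M0 c t by (intro mult_mono) auto
    then show ?thesis
      using M[of t] True t by (simp add: C_def)
  next
    case False
    have "norm (T t x) \<le> C * exp (c * t) * norm x" for x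
    proof -
      define q where "q = exp (- c * t) * norm (T t x)"
      have cont: "continuous_on {t - 1..t} (\<lambda>s. T s x)"
        using False by (intro continuous_on_subset[OF continuous_on_T[of t]]) auto
      have q_le: "q\<^sup>2 \<le> M\<^sup>2 * (exp (- c * s) * norm (T s x))\<^sup>2" if s: "s \<in> {t - 1..t}" for s
      proof -
        have "norm (T t x) \<le> onorm (T (t - s)) * norm (T s x)"
          using norm_T_le[of "t - s" "T s x"] T_add[of "t - s" s x] s False by simp
        also have "\<dots> \<le> M * norm (T s x)"
          using M[of "t - s"] s by (intro mult_right_mono) auto
        finally have "q \<le> exp (- c * s) * (M * norm (T s x))"
          unfolding q_def using s c by (intro mult_mono) auto
        then have "q\<^sup>2 \<le> (exp (- c * s) * (M * norm (T s x)))\<^sup>2"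
          by (intro power_mono) (auto simp: q_def)
        then show ?thesis
          by (simp add: power_mult_distrib mult_ac)
      qed
      have "q\<^sup>2 = integral {t - 1..t} (\<lambda>s. q\<^sup>2)"
        by simp
      also have "\<dots> \<le> integral {t - 1..t} (\<lambda>s. M\<^sup>2 * (exp (- c * s) * norm (T s x))\<^sup>2)"
        by (intro integral_le q_le integrable_continuous_real continuous_intros cont) auto
      also have "\<dots> = M\<^sup>2 * integral {t - 1..t} (\<lambda>s. (exp (- c * s) * norm (T s x))\<^sup>2)"
        by simp
      also have "\<dots> \<le> M\<^sup>2 * (2 * K * \<omega> * M\<^sub>\<omega> * norm x)\<^sup>2"
        using False by (intro mult_left_mono integral_orbit_le[OF c K N]) auto
      also have "\<dots> = (2 * M * K * \<omega> * M\<^sub>\<omega> * norm x)\<^sup>2"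
        by (simp add: power_mult_distrib mult_ac)
      finally have "q \<le> 2 * M * K * \<omega> * M\<^sub>\<omega> * norm x"
        by (rule power2_le_imp_le) (use M0 K0 omega M_omega in auto)
      also have "\<dots> \<le> C * norm x"
        using C(2) by (intro mult_right_mono) auto
      finally have "exp (c * t) * q \<le> exp (c * t) * (C * norm x)"
        by (intro mult_left_mono) auto
      moreover have "exp (c * t) * q = norm (T t x)"
        by (simp add: q_def exp_minus)
      ultimately show ?thesis
        by (simp only: mult_ac)
    qed
    then show ?thesis
      unfolding C_def[symmetric] using C(1) M0 by (intro onorm_bound) auto
  qed
qed

text \<open>This is the argument of Datko's theorem: a semigroup that is bounded, with orbits bounded
  in the quadratic mean, decays. What matters is that the time at which the norm has dropped to
  one half depends only on the two bounds.\<close>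

lemma onorm_T_le_half:
  assumes L: "\<And>x. integral {1..t} (\<lambda>s. (exp (- c * s) * norm (T s x))\<^sup>2) \<le> (L * norm x)\<^sup>2"
    and C: "\<And>s. s \<ge> 0 \<Longrightarrow> onorm (T s) \<le> C * exp (c * s)"
    and t: "t = 2 + 4 * (C * L)\<^sup>2"
  shows "onorm (T t) \<le> exp (c * t) / 2"
proof (rule onorm_bound)
  fix x
  have t2: "t \<ge> 2"
    by (simp add: t)
  define q where "q = exp (- c * t) * norm (T t x)"
  have cont: "continuous_on {1..t} (\<lambda>s. T s x)"
    by (intro continuous_on_subset[OF continuous_on_T[of t]]) auto
  have q_le: "q\<^sup>2 \<le> C\<^sup>2 * (exp (- c * s) * norm (T s x))\<^sup>2" if s: "s \<in> {1..t}" for s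
  proof -
    have "norm (T t x) \<le> onorm (T (t - s)) * norm (T s x)"
      using norm_T_le[of "t - s" "T s x"] T_add[of "t - s" s x] s by simp
    also have "\<dots> \<le> C * exp (c * (t - s)) * norm (T s x)"
      using C[of "t - s"] s by (intro mult_right_mono) auto
    finally have "q \<le> exp (- c * t) * (C * exp (c * (t - s)) * norm (T s x))"
      unfolding q_def by (intro mult_left_mono) auto
    also have "\<dots> = C * ((exp (- c * t) * exp (c * (t - s))) * norm (T s x))"
      by (simp only: mult_ac)
    also have "exp (- c * t) * exp (c * (t - s)) = exp (- c * s)"
      by (simp add: algebra_simps flip: exp_add)
    finally have "q\<^sup>2 \<le> (C * (exp (- c * s) * norm (T s x)))\<^sup>2"
      by (intro power_mono) (auto simp: q_def)
    then show ?thesis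
      by (simp add: power_mult_distrib)
  qed
  have "(t - 1) * q\<^sup>2 = integral {1..t} (\<lambda>s. q\<^sup>2)"
    using t2 by simp
  also have "\<dots> \<le> integral {1..t} (\<lambda>s. C\<^sup>2 * (exp (- c * s) * norm (T s x))\<^sup>2)"
    by (intro integral_le q_le integrable_continuous_real continuous_intros cont) auto
  also have "\<dots> = C\<^sup>2 * integral {1..t} (\<lambda>s. (exp (- c * s) * norm (T s x))\<^sup>2)"
    by simp
  also have "\<dots> \<le> C\<^sup>2 * (L * norm x)\<^sup>2"
    by (intro mult_left_mono L) auto
  finally have "(1 + 4 * (C * L)\<^sup>2) * q\<^sup>2 \<le> (C * L)\<^sup>2 * (norm x)\<^sup>2"
    by (simp add: t power_mult_distrib)
  then have "(1 + 4 * (C * L)\<^sup>2) * (4 * q\<^sup>2) \<le> (4 * (C * L)\<^sup>2) * (norm x)\<^sup>2"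
    by simp
  also have "\<dots> \<le> (1 + 4 * (C * L)\<^sup>2) * (norm x)\<^sup>2"
    by (intro mult_right_mono) auto
  finally have "4 * q\<^sup>2 \<le> (norm x)\<^sup>2"
    by (rule mult_left_le_imp_le) (simp add: add_pos_nonneg)
  then have "(2 * q)\<^sup>2 \<le> (norm x)\<^sup>2"
    by (simp add: power_mult_distrib)
  then have "2 * q \<le> norm x"
    by (rule power2_le_imp_le) simp
  then have "exp (c * t) / 2 * (2 * q) \<le> exp (c * t) / 2 * norm x"
    by (intro mult_left_mono) auto
  moreover have "exp (c * t) / 2 * (2 * q) = norm (T t x)"
    by (simp add: q_def exp_minus)
  ultimately show "norm (T t x) \<le> exp (c * t) / 2 * norm x"
    by (simp only:)
qed simp

text \<open>One time with a small norm determines the rate of growth: other times are reduced by multiples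
  of \<open>t\<close> to the interval from \<open>0\<close> to \<open>t\<close>, where the given growth bound is used.\<close>

lemma exponential_bound_of_onorm_le:
  assumes t: "t > 0" and b: "onorm (T t) \<le> exp (b * t)"
  obtains N where "\<And>s. s \<ge> 0 \<Longrightarrow> onorm (T s) \<le> N * exp (b * s)"
proof -
  define N where "N = M\<^sub>\<omega> * exp (t * (\<omega> - 1)) * exp (\<bar>b\<bar> * t)"
  have N: "N \<ge> 0"
    using M_omega by (simp add: N_def)
  have base: "onorm (T s) \<le> N * exp (b * s)" if s: "0 \<le> s" "s \<le> t" for s
  proof -
    have "onorm (T s) \<le> M\<^sub>\<omega> * exp (t * (\<omega> - 1))"
      by (rule onorm_T_le_of_le[OF s])
    also have "\<dots> = M\<^sub>\<omega> * exp (t * (\<omega> - 1)) * 1"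
      by simp
    also have "\<dots> \<le> M\<^sub>\<omega> * exp (t * (\<omega> - 1)) * (exp (\<bar>b\<bar> * t) * exp (b * s))"
    proof (rule mult_left_mono)
      have "- b * s \<le> \<bar>b\<bar> * t"
        using s by (intro mult_mono) auto
      then show "1 \<le> exp (\<bar>b\<bar> * t) * exp (b * s)"
        by (simp flip: exp_add)
    qed (use M_omega in simp)
    finally show ?thesis
      by (simp add: N_def mult.assoc)
  qed
  have "onorm (T s) \<le> N * exp (b * s)" if "0 \<le> s" "s \<le> real n * t" for n s
    using that
  proof (induction n arbitrary: s)
    case 0
    then show ?case
      using base[of s] t by simp
  next
    case (Suc n)
    show ?case
    proof (cases "s \<le> t")
      case True
      then show ?thesis
        using base Suc.prems by simp
    next
      case False
      have "onorm (T s) \<le> onorm (T t) * onorm (T (s - t))"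
        using onorm_T_add_le[of t "s - t"] t False by simp
      also have "\<dots> \<le> exp (b * t) * (N * exp (b * (s - t)))"
        using Suc.prems False b t onorm_T_nonneg[of "s - t"]
        by (intro mult_mono Suc.IH) (auto simp: algebra_simps)
      also have "\<dots> = N * (exp (b * t) * exp (b * (s - t)))"
        by (simp only: mult_ac)
      also have "exp (b * t) * exp (b * (s - t)) = exp (b * s)"
        by (simp add: algebra_simps flip: exp_add)
      finally show ?thesis .
    qed
  qed
  moreover have "\<exists>n. s \<le> real n * t" for s
    using reals_Archimedean3[OF t] by (meson less_imp_le)
  ultimately show thesis
    using that by blast
qed

text \<open>The rate \<open>c\<close> of exponential growth can be lowered by the fixed amount \<open>\<delta>\<close> as long as it is
  at least \<open>a\<close>. Finitely many such steps lead from the given growth bound to the rate \<open>a\<close>.\<close>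

lemma exponential_bound_of_resolvent_bound:
  assumes a: "a > 0" and K: "\<And>l. Re l \<ge> a \<Longrightarrow> onorm (R l) \<le> K" and K0: "K \<ge> 0"
    and M: "\<And>s. s \<in> {0..2} \<Longrightarrow> onorm (T s) \<le> M"
  shows "\<exists>N. \<forall>s\<ge>0. onorm (T s) \<le> N * exp (a * s)"
proof -
  define Q where "Q b \<longleftrightarrow> (\<exists>N. \<forall>s\<ge>0. onorm (T s) \<le> N * exp (b * s))" for b
  define C where "C = M\<^sub>\<omega> * (1 + 2 * M * \<omega>) * (K + 1)"
  define t where "t = 2 + 4 * (C * (2 * K * \<omega> * M\<^sub>\<omega>))\<^sup>2"
  define \<delta> where "\<delta> = ln 2 / t"
  have t: "t \<ge> 2"
    by (simp add: t_def)
  have \<delta>: "\<delta> > 0"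
    using t by (simp add: \<delta>_def)
  have step: "Q (c - \<delta>)" if Q: "Q c" and c: "c \<ge> a" for c
  proof -
    obtain N where N: "\<And>s. s \<ge> 0 \<Longrightarrow> onorm (T s) \<le> N * exp (c * s)"
      using Q unfolding Q_def by blast
    have c0: "c > 0" and Kc: "\<And>l. Re l = c \<Longrightarrow> onorm (R l) \<le> K"
      using a c K by auto
    have "integral {1..t} (\<lambda>s. (exp (- c * s) * norm (T s x))\<^sup>2) \<le> (2 * K * \<omega> * M\<^sub>\<omega> * norm x)\<^sup>2" for x
      using t by (intro integral_orbit_le[OF c0 Kc N]) auto
    moreover have "onorm (T s) \<le> C * exp (c * s)" if "s \<ge> 0" for s
      unfolding C_def by (rule onorm_T_le[OF c0 Kc K0 N M that])
    ultimately have "onorm (T t) \<le> exp (c * t) / 2"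
      using t_def by (intro onorm_T_le_half[where C = C and L = "2 * K * \<omega> * M\<^sub>\<omega>"])
    also have "\<dots> = exp ((c - \<delta>) * t)"
      using t by (simp add: \<delta>_def left_diff_distrib exp_diff)
    finally obtain N' where "\<And>s. s \<ge> 0 \<Longrightarrow> onorm (T s) \<le> N' * exp ((c - \<delta>) * s)"
      using exponential_bound_of_onorm_le[of t "c - \<delta>"] t by auto
    then show ?thesis
      unfolding Q_def by blast
  qed
  have mono: "Q c" if Q: "Q b" and "b \<le> c" for b c
  proof -
    obtain N where N: "\<And>s. s \<ge> 0 \<Longrightarrow> onorm (T s) \<le> N * exp (b * s)"
      using Q unfolding Q_def by blast
    have "N \<ge> 0"
      using N[of 0] onorm_T_nonneg[of 0] by simp
    then have "onorm (T s) \<le> N * exp (c * s)" if "s \<ge> 0" for s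
      using N[OF that] \<open>b \<le> c\<close> that
      by (elim order_trans) (intro mult_left_mono, auto intro: mult_right_mono)
    then show ?thesis
      unfolding Q_def by blast
  qed
  \<comment> \<open>The maximum stops the descent at \<open>a\<close>, below which the resolvent need not be bounded by \<open>K\<close>.\<close>
  have "Q (max a (\<omega> - 1 - real n * \<delta>))" for n
  proof (induction n)
    case 0
    have "Q (\<omega> - 1)"
      unfolding Q_def using growth by (intro exI[of _ M\<^sub>\<omega>]) (simp add: mult.commute)
    then show ?case
      by (rule mono) simp
  next
    case (Suc n)
    from step[OF Suc.IH] show ?case
      by (rule mono) (use \<delta> in \<open>auto simp: algebra_simps max_def\<close>)
  qed
  moreover obtain n where "\<omega> - 1 - a < real n * \<delta>"
    using reals_Archimedean3[OF \<delta>] by blast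
  then have "max a (\<omega> - 1 - real n * \<delta>) = a"
    by auto
  ultimately have "Q a"
    by metis
  then show ?thesis
    by (simp add: Q_def)
qed

end

theorem theorem3p4:
  fixes T :: "real \<Rightarrow> 'a \<Rightarrow> 'a::complex_hilbert_space"
    and A :: "'a \<Rightarrow> 'a" and D :: "'a set"
    and \<omega> M\<^sub>\<omega> M :: real and g :: "real \<Rightarrow> real"
  assumes nonzero: "\<exists>x::'a. x \<noteq> 0"
    and semigroup: "C0_semigroup T"
    and generator: "is_generator D (\<lambda>x. - A x) T"
    and spectrum: "{l. Re l < 0} \<subseteq> resolvent_set D A"
    and omega: "\<omega> \<ge> 1" and M_omega: "M\<^sub>\<omega> \<ge> 1"
    and growth: "\<And>t. t \<ge> 0 \<Longrightarrow> onorm (T t) \<le> M\<^sub>\<omega> * exp (t * (\<omega> - 1))"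
    and M_def: "M = (SUP t\<in>{0..2}. onorm (T t))"
    and g_pos: "\<And>s. s > 0 \<Longrightarrow> g s > 0"
    and g_mono: "mono_on {0<..} g"
    and resolvent_bound: "\<And>l. Re l > 0 \<Longrightarrow>
          onorm (inv_into D (\<lambda>x. l *\<^sub>C x + A x)) \<le> g (inverse (Re l))"
  shows "\<forall>t>0. onorm (T t) \<le> exp 1 * M\<^sub>\<omega> * (1 + 2 * M * \<omega>) * (g t + 1)"
proof (intro allI impI)
  fix t :: real assume t: "t > 0"
  interpret exponential_semigroup T A D \<omega> M\<^sub>\<omega>
    by unfold_locales (fact semigroup generator spectrum omega M_omega growth)+
  have M: "onorm (T s) \<le> M" if s: "s \<in> {0..2}" for s
    unfolding M_def
  proof (rule cSUP_upper[OF s])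
    have "onorm (T r) \<le> M\<^sub>\<omega> * exp (2 * (\<omega> - 1))" if "r \<in> {0..2}" for r
      using onorm_T_le_of_le[of r 2] that by simp
    then show "bdd_above ((\<lambda>t. onorm (T t)) ` {0..2})"
      by (intro bdd_aboveI2)
  qed
  \<comment> \<open>With this rate, the exponential factor in the bound at time \<open>t\<close> is \<open>exp 1\<close>.\<close>
  define a where "a = 1 / t"
  have a: "a > 0" "a * t = 1"
    using t by (simp_all add: a_def)
  have K: "onorm (R l) \<le> g t" if l: "Re l \<ge> a" for l
  proof -
    have l0: "Re l > 0"
      using a(1) l by simp
    have "inverse (Re l) \<le> t"
      using le_imp_inverse_le[OF l a(1)] by (simp add: a_def)
    then have "g (inverse (Re l)) \<le> g t"
      using l0 t by (intro mono_onD[OF g_mono]) auto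
    then show ?thesis
      using resolvent_bound[OF l0] by simp
  qed
  have g0: "g t \<ge> 0"
    using g_pos[OF t] by simp
  obtain N where N: "\<And>s. s \<ge> 0 \<Longrightarrow> onorm (T s) \<le> N * exp (a * s)"
    using exponential_bound_of_resolvent_bound[OF a(1) K g0 M] by blast
  have "onorm (T t) \<le> M\<^sub>\<omega> * (1 + 2 * M * \<omega>) * (g t + 1) * exp (a * t)"
    using t by (intro onorm_T_le[OF a(1) K g0 N M]) auto
  then show "onorm (T t) \<le> exp 1 * M\<^sub>\<omega> * (1 + 2 * M * \<omega>) * (g t + 1)"
    by (simp add: a(2) mult_ac)
qed

end
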